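(* Consider the random linear network coding algorithm over the field $F_q$ with $q = n^{\Omega(k)}$. It solves the $k$-indexed-broadcast problem in an always-connected dynamic network against an omniscient adversary with probability at least $1 - q^{-n}$ in $O(n + k)$ rounds. It uses messages of size $k^2 \log n + d$ bits, where $d$ is the size of a token.
   Context: Dynamic network: $n$ nodes; synchronous rounds; in each round $t$ an adversary chooses a connected undirected graph $G(t)$ on the nodes; each node chooses its message for the round without knowing its neighbors and then receives the messages of all its neighbors in $G(t)$. An omniscient adversary knows all random choices of the algorithm in advance and may choose the graphs based on them. $k$-indexed-broadcast: $k$ tokens $t_1,\dots,t_k$ of $d$ bits each, with distinct indices $1,\dots,k$ known to the nodes initially holding them, must be delivered to all nodes. Random linear network coding algorithm with field size $q$ (prime): each token is represented as a vector $t_i\in F_q^{d'}$ with $d'=\lceil d/\log_2 q\rceil$; the $i$-th standard basis vector $e_i\in F_q^k$ is concatenated with $t_i$ to give $v_i\in F_q^{k+d'}$, and every node initially knowing $t_i$ holds $v_i$. In every round each node broadcasts a uniformly random linear combination (coefficients independent uniform in $F_q$) of all vectors it holds or has received so far; a node decodes by Gaussian elimination once the vectors it has span all $v_i$.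
   Formalization: Random coefficients are drawn only for the innovative vectors a node holds (same message distribution; with coins on redundant vectors an omniscient adversary wins). Ω(k) means a large enough constant; message size is up to a constant factor and assumes q ≤ n^{O(k)}. *)

theory Defs
  imports "HOL-Probability.Probability" "HOL-Probability.Product_PMF" "HOL-Computational_Algebra.Primes"
begin

section \<open>Vectors over the prime field with \<open>q\<close> elements\<close>

text \<open>
  The bounds of the result are uniform in \<open>q\<close>, so the field cannot be a type. Its elements are
  the residues \<open>{0..<q}\<close> and its operations are those of the integers modulo \<open>q\<close>.
\<close>

type_synonym fvec = "nat \<Rightarrow> int"

definition field_vecs :: "nat \<Rightarrow> nat \<Rightarrow> fvec set" where
  "field_vecs q m = {..<m} \<rightarrow>\<^sub>E {0..<int q}"

definition lincomb :: "nat \<Rightarrow> nat \<Rightarrow> (nat \<Rightarrow> int) \<Rightarrow> fvec list \<Rightarrow> fvec" where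
  "lincomb q m c vs = (\<lambda>j\<in>{..<m}. (\<Sum>i<length vs. c i * (vs ! i) j) mod int q)"

definition vspan :: "nat \<Rightarrow> nat \<Rightarrow> fvec list \<Rightarrow> fvec set" where
  "vspan q m vs = range (\<lambda>c. lincomb q m c vs)"

text \<open>
  The sublist of the vectors that are not spanned by their predecessors. It is a basis of the span.
\<close>

definition innovative :: "nat \<Rightarrow> nat \<Rightarrow> fvec list \<Rightarrow> fvec list" where
  "innovative q m vs = foldl (\<lambda>bs x. if x \<in> vspan q m bs then bs else bs @ [x]) [] vs"


section \<open>Dynamic networks\<close>

type_synonym graph = "(nat \<times> nat) set"

definition connected_graph :: "nat \<Rightarrow> graph \<Rightarrow> bool" where
  "connected_graph n E \<longleftrightarrow>
     E \<subseteq> {..<n} \<times> {..<n} \<and> sym E \<and> irrefl E \<and> (\<forall>u<n. \<forall>v<n. (u, v) \<in> E\<^sup>*)"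

definition always_connected :: "nat \<Rightarrow> (nat \<Rightarrow> graph) \<Rightarrow> bool" where
  "always_connected n G \<longleftrightarrow> (\<forall>t. connected_graph n (G t))"


section \<open>Tokens and their initial distribution\<close>

text \<open>Tokens are indexed by \<open>{..<k}\<close>, nodes by \<open>{..<n}\<close>.\<close>

definition tok_dim :: "nat \<Rightarrow> nat \<Rightarrow> nat" where
  "tok_dim d q = nat \<lceil>real d / log 2 (real q)\<rceil>"

definition vec_dim :: "nat \<Rightarrow> nat \<Rightarrow> nat \<Rightarrow> nat" where
  "vec_dim k d q = k + tok_dim d q"

definition tok_vec :: "nat \<Rightarrow> nat \<Rightarrow> nat \<Rightarrow> (nat \<Rightarrow> fvec) \<Rightarrow> nat \<Rightarrow> fvec" where
  "tok_vec q k d tok i =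
     (\<lambda>j\<in>{..<vec_dim k d q}. if j < k then (if j = i then 1 else 0) else tok i (j - k))"

text \<open>
  \<open>tok i\<close> is the representation of token \<open>i\<close> over the field, and \<open>I u\<close> is the set of indices of
  the tokens that node \<open>u\<close> knows initially.
\<close>

definition broadcast_instance ::
    "nat \<Rightarrow> nat \<Rightarrow> nat \<Rightarrow> nat \<Rightarrow> (nat \<Rightarrow> fvec) \<Rightarrow> (nat \<Rightarrow> nat set) \<Rightarrow> bool" where
  "broadcast_instance q n k d tok I \<longleftrightarrow>
     (\<forall>i<k. tok i \<in> field_vecs q (tok_dim d q)) \<and>
     (\<forall>u<n. I u \<subseteq> {..<k}) \<and> (\<forall>i<k. \<exists>u<n. i \<in> I u)"


section \<open>Random linear network coding\<close>

text \<open>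
  The coin \<open>\<omega> (t, u, j)\<close> is the \<open>j\<close>-th coefficient of node \<open>u\<close> in round \<open>t\<close>. All coins of an
  execution of \<open>T\<close> rounds are drawn in advance, so that an omniscient adversary is an arbitrary
  function from the coins to the graphs of all rounds.

  A message is a uniformly random linear combination of all known vectors. With fixed coins and an
  adversary that knows them, the way in which such a combination is computed from the coins
  matters. The coefficients are attached to the innovative known vectors, of which there are at most
  \<open>k\<close>; the lemma \<open>lincomb_innovative_distribution\<close> below says that the resulting combination is
  distributed like a combination of all known vectors. If independent coins were attached to
  redundant vectors as well, the adversary could use the delivery of redundant vectors to make the
  later messages of a node vanish.
\<close>

type_synonym coins = "nat \<times> nat \<times> nat \<Rightarrow> int"

definition coin_pmf :: "nat \<Rightarrow> nat \<Rightarrow> nat \<Rightarrow> nat \<Rightarrow> coins pmf" where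
  "coin_pmf q n k T = Pi_pmf ({..<T} \<times> {..<n} \<times> {..<k}) 0 (\<lambda>_. pmf_of_set {0..<int q})"

text \<open>
  \<open>known \<dots> G t u\<close> lists the vectors that node \<open>u\<close> holds or has received before round \<open>t\<close>.
\<close>

primrec known :: "nat \<Rightarrow> nat \<Rightarrow> nat \<Rightarrow> (nat \<Rightarrow> fvec) \<Rightarrow> (nat \<Rightarrow> nat set) \<Rightarrow> coins \<Rightarrow>
    (nat \<Rightarrow> graph) \<Rightarrow> nat \<Rightarrow> nat \<Rightarrow> fvec list" where
  "known q k d tok I \<omega> G 0 u = map (tok_vec q k d tok) (sorted_list_of_set (I u))"
| "known q k d tok I \<omega> G (Suc t) u =
     known q k d tok I \<omega> G t u @
     map (\<lambda>w. lincomb q (vec_dim k d q) (\<lambda>j. \<omega> (t, w, j))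
                (innovative q (vec_dim k d q) (known q k d tok I \<omega> G t w)))
       (sorted_list_of_set {w. (w, u) \<in> G t})"

definition message :: "nat \<Rightarrow> nat \<Rightarrow> nat \<Rightarrow> (nat \<Rightarrow> fvec) \<Rightarrow> (nat \<Rightarrow> nat set) \<Rightarrow> coins \<Rightarrow>
    (nat \<Rightarrow> graph) \<Rightarrow> nat \<Rightarrow> nat \<Rightarrow> fvec" where
  "message q k d tok I \<omega> G t u =
     lincomb q (vec_dim k d q) (\<lambda>j. \<omega> (t, u, j))
       (innovative q (vec_dim k d q) (known q k d tok I \<omega> G t u))"

lemma known_Suc_eq_messages:
  "known q k d tok I \<omega> G (Suc t) u =
     known q k d tok I \<omega> G t u @
     map (message q k d tok I \<omega> G t) (sorted_list_of_set {w. (w, u) \<in> G t})"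
  by (simp add: message_def[abs_def])

definition all_decoded :: "nat \<Rightarrow> nat \<Rightarrow> nat \<Rightarrow> nat \<Rightarrow> (nat \<Rightarrow> fvec) \<Rightarrow> (nat \<Rightarrow> nat set) \<Rightarrow>
    coins \<Rightarrow> (nat \<Rightarrow> graph) \<Rightarrow> nat \<Rightarrow> bool" where
  "all_decoded q n k d tok I \<omega> G t \<longleftrightarrow>
     (\<forall>u<n. \<forall>i<k. tok_vec q k d tok i \<in> vspan q (vec_dim k d q) (known q k d tok I \<omega> G t u))"

text \<open>
  All messages that can be sent in some round of some execution of \<open>T\<close> rounds, for fixed \<open>n\<close>,
  \<open>k\<close>, \<open>d\<close> and \<open>q\<close>.
\<close>

definition possible_messages :: "nat \<Rightarrow> nat \<Rightarrow> nat \<Rightarrow> nat \<Rightarrow> nat \<Rightarrow> fvec set" where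
  "possible_messages q n k d T =
     {message q k d tok I \<omega> G t u | tok I \<omega> G t u.
        broadcast_instance q n k d tok I \<and> \<omega> \<in> set_pmf (coin_pmf q n k T) \<and>
        always_connected n G \<and> t < T \<and> u < n}"

definition encodable_with_bits :: "'a set \<Rightarrow> nat \<Rightarrow> bool" where
  "encodable_with_bits M b \<longleftrightarrow>
     (\<exists>enc :: 'a \<Rightarrow> bool list. inj_on enc M \<and> (\<forall>x\<in>M. length (enc x) = b))"


section \<open>Innovative vectors suffice for uniformly random combinations\<close>

definition uniform_coeffs :: "nat \<Rightarrow> nat \<Rightarrow> (nat \<Rightarrow> int) pmf" where
  "uniform_coeffs q l = Pi_pmf {..<l} 0 (\<lambda>_. pmf_of_set {0..<int q})"

definition add_multiple :: "nat \<Rightarrow> nat \<Rightarrow> fvec \<Rightarrow> int \<Rightarrow> fvec \<Rightarrow> fvec" where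
  "add_multiple q m y a x = (\<lambda>j\<in>{..<m}. (y j + a * x j) mod int q)"

lemma lincomb_snoc:
  "lincomb q m (c(length vs := a)) (vs @ [x]) = add_multiple q m (lincomb q m c vs) a x"
proof -
  have "(\<Sum>i<length vs. (c(length vs := a)) i * ((vs @ [x]) ! i) j) =
        (\<Sum>i<length vs. c i * (vs ! i) j)" for j
    by (intro sum.cong) (auto simp: nth_append)
  then show ?thesis
    by (auto simp: lincomb_def add_multiple_def fun_eq_iff mod_simps)
qed

lemma lincomb_uniform_snoc:
  "map_pmf (\<lambda>c. lincomb q m c (vs @ [x])) (uniform_coeffs q (length (vs @ [x]))) =
   do {a \<leftarrow> pmf_of_set {0..<int q};
       map_pmf (\<lambda>y. add_multiple q m y a x)
         (map_pmf (\<lambda>c. lincomb q m c vs) (uniform_coeffs q (length vs)))}"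
proof -
  have "uniform_coeffs q (length (vs @ [x])) =
      do {a \<leftarrow> pmf_of_set {0..<int q}; c \<leftarrow> uniform_coeffs q (length vs);
          return_pmf (c(length vs := a))}"
    unfolding uniform_coeffs_def by (simp add: lessThan_Suc Pi_pmf_insert')
  then show ?thesis
    by (simp add: map_pmf_def bind_assoc_pmf bind_return_pmf lincomb_snoc)
qed

lemma uniform_coeffs_shift:
  assumes "q > 0"
  shows "map_pmf (\<lambda>c i. if i < l then (c i + h i) mod int q else 0) (uniform_coeffs q l) =
         uniform_coeffs q l"
proof -
  define S where "S = PiE_dflt {..<l} (0::int) (\<lambda>_. {0..<int q})"
  have U: "uniform_coeffs q l = pmf_of_set S"
    unfolding uniform_coeffs_def S_def using assms by (intro Pi_pmf_of_set) auto
  have "finite S" "S \<noteq> {}"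
    using assms by (auto simp: S_def)
  have "bij_betw (\<lambda>c i. if i < l then (c i + h i) mod int q else 0) S S"
    by (rule bij_betwI[where g = "\<lambda>c i. if i < l then (c i - h i) mod int q else 0"])
       (use assms in \<open>auto simp: S_def PiE_dflt_def fun_eq_iff mod_simps\<close>)
  then show ?thesis
    unfolding U using \<open>S \<noteq> {}\<close> \<open>finite S\<close> by (rule map_pmf_of_set_bij_betw)
qed

lemma lincomb_uniform_add_spanned:
  assumes "q > 0" "x \<in> vspan q m bs"
  shows "map_pmf (\<lambda>y. add_multiple q m y a x)
           (map_pmf (\<lambda>c. lincomb q m c bs) (uniform_coeffs q (length bs))) =
         map_pmf (\<lambda>c. lincomb q m c bs) (uniform_coeffs q (length bs))"
proof -
  obtain b where b: "x = lincomb q m b bs"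
    using assms(2) by (auto simp: vspan_def)
  let ?shift = "\<lambda>c i. if i < length bs then (c i + a * b i) mod int q else 0"
  have "add_multiple q m (lincomb q m c bs) a x = lincomb q m (?shift c) bs" for c
  proof
    fix j
    have "(\<Sum>i<length bs. ?shift c i * (bs ! i) j) mod int q =
          (\<Sum>i<length bs. (?shift c i * (bs ! i) j) mod int q) mod int q"
      by (rule mod_sum_eq[symmetric])
    also have "\<dots> = (\<Sum>i<length bs. ((c i + a * b i) * (bs ! i) j) mod int q) mod int q"
      by (simp add: mod_mult_left_eq)
    also have "\<dots> = (\<Sum>i<length bs. (c i + a * b i) * (bs ! i) j) mod int q"
      by (rule mod_sum_eq)
    also have "(\<Sum>i<length bs. (c i + a * b i) * (bs ! i) j) =
        (\<Sum>i<length bs. c i * (bs ! i) j) + a * (\<Sum>i<length bs. b i * (bs ! i) j)"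
      by (simp add: algebra_simps sum.distrib sum_distrib_left)
    finally have "(\<Sum>i<length bs. ?shift c i * (bs ! i) j) mod int q =
        ((\<Sum>i<length bs. c i * (bs ! i) j) + a * (\<Sum>i<length bs. b i * (bs ! i) j)) mod int q" .
    moreover have "(u mod int q + a * (v mod int q)) mod int q = (u + a * v) mod int q" for u v
      by (rule mod_add_cong) (simp_all add: mod_mult_right_eq)
    ultimately show "add_multiple q m (lincomb q m c bs) a x j = lincomb q m (?shift c) bs j"
      unfolding b add_multiple_def lincomb_def by (cases "j < m") simp_all
  qed
  then have "map_pmf (\<lambda>y. add_multiple q m y a x)
      (map_pmf (\<lambda>c. lincomb q m c bs) (uniform_coeffs q (length bs))) =
    map_pmf (\<lambda>c. lincomb q m c bs) (map_pmf ?shift (uniform_coeffs q (length bs)))"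
    by (simp add: pmf.map_comp o_def)
  then show ?thesis
    by (simp only: uniform_coeffs_shift[OF assms(1)])
qed

lemma lincomb_innovative_distribution:
  assumes "q > 0"
  shows "map_pmf (\<lambda>c. lincomb q m c (innovative q m vs))
           (uniform_coeffs q (length (innovative q m vs))) =
         map_pmf (\<lambda>c. lincomb q m c vs) (uniform_coeffs q (length vs))"
proof (induction vs rule: rev_induct)
  case Nil
  then show ?case by (simp add: innovative_def)
next
  case (snoc x vs)
  define bs where "bs = innovative q m vs"
  note IH = snoc.IH[folded bs_def]
  have step: "innovative q m (vs @ [x]) = (if x \<in> vspan q m bs then bs else bs @ [x])"
    by (simp add: innovative_def bs_def)
  show ?case
  proof (cases "x \<in> vspan q m bs")
    case True
    then show ?thesis
      unfolding lincomb_uniform_snoc IH[symmetric]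
      by (simp add: step lincomb_uniform_add_spanned[OF assms True])
  next
    case False
    then have "innovative q m (vs @ [x]) = bs @ [x]"
      by (simp add: step)
    then show ?thesis
      by (simp only: lincomb_uniform_snoc IH)
  qed
qed

end

theory Submission
  imports Defs
begin

text \<open>
  The proof is a union bound over short witnesses of failure. The adversary influences an execution
  only through the transmissions that are innovative for some node. Every node has at most \<open>k\<close> of
  them, so they can be listed in \<open>(n (T + 1))\<^sup>k\<^sup>n\<close> ways, and for \<open>T = O(n + k)\<close> this number is at most
  \<open>n\<close> to the power \<open>O(k (n + k))\<close>, which \<open>q \<ge> n\<^sup>1\<^sup>0\<^sup>k\<close> turns into \<open>q\<close> to the power \<open>O(n + k)\<close>. Once
  this list is fixed, the basis of each node is a function of the earlier coins alone.

  A node senses \<open>\<mu> \<in> F\<^sub>q\<^sup>k\<close> if it knows a vector that is not orthogonal to \<open>\<mu>\<close>; a node that senses all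
  nonzero \<open>\<mu>\<close> can decode. A round is bad for \<open>\<mu>\<close> if some node that senses \<open>\<mu>\<close> sends a message
  orthogonal to \<open>\<mu>\<close>. Given the past, this has probability at most \<open>n / q\<close>. By connectivity every
  round that is not bad enlarges the set of nodes sensing \<open>\<mu>\<close>, so a failure needs at least \<open>T - n\<close>
  bad rounds for some \<open>\<mu>\<close>, which for a fixed list, \<open>\<mu>\<close> and set of rounds has probability at most
  \<open>(n / q)\<^sup>T\<^sup>-\<^sup>n\<close>.
\<close>


section \<open>Linear algebra modulo a prime\<close>

lemma innovative_snoc:
  "innovative q m (vs @ [x]) =
     (if x \<in> vspan q m (innovative q m vs) then innovative q m vs else innovative q m vs @ [x])"
  by (simp add: innovative_def)

lemma innovative_Nil: "innovative q m [] = []"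
  by (simp add: innovative_def)

lemma set_innovative_subset: "set (innovative q m vs) \<subseteq> set vs"
  by (induction vs rule: rev_induct) (auto simp: innovative_Nil innovative_snoc)

lemma lincomb_in_field_vecs: "q > 0 \<Longrightarrow> lincomb q m c vs \<in> field_vecs q m"
  by (auto simp: lincomb_def field_vecs_def)

lemma vspan_subset_field_vecs: "q > 0 \<Longrightarrow> vspan q m vs \<subseteq> field_vecs q m"
  by (auto simp: vspan_def lincomb_in_field_vecs)

lemma finite_field_vecs: "finite (field_vecs q m)"
  by (auto simp: field_vecs_def intro!: finite_PiE)

lemma card_field_vecs: "card (field_vecs q m) = q ^ m"
  by (simp add: field_vecs_def card_PiE)

text \<open>Coefficients matter only modulo \<open>q\<close>, so finitely many of them produce the
  whole span. This allows dimensions to be compared through cardinalities.\<close>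

lemma vspan_eq_image:
  assumes "q > 0"
  shows "vspan q m vs = (\<lambda>c. lincomb q m c vs) ` field_vecs q (length vs)"
proof
  show "vspan q m vs \<subseteq> (\<lambda>c. lincomb q m c vs) ` field_vecs q (length vs)"
  proof
    fix x assume "x \<in> vspan q m vs"
    then obtain c where c: "x = lincomb q m c vs" by (auto simp: vspan_def)
    let ?c = "\<lambda>i\<in>{..<length vs}. c i mod int q"
    have "(\<Sum>i<length vs. ?c i * (vs ! i) j) mod int q = (\<Sum>i<length vs. c i * (vs ! i) j) mod int q" for j
    proof -
      have "(\<Sum>i<length vs. ?c i * (vs ! i) j) mod int q
        = (\<Sum>i<length vs. (?c i * (vs ! i) j) mod int q) mod int q"
        by (rule mod_sum_eq[symmetric])
      also have "\<dots> = (\<Sum>i<length vs. (c i * (vs ! i) j) mod int q) mod int q"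
        by (simp add: mod_mult_left_eq)
      finally show ?thesis by (simp only: mod_sum_eq)
    qed
    then have "x = lincomb q m ?c vs"
      unfolding c lincomb_def by (auto simp: fun_eq_iff)
    moreover have "?c \<in> field_vecs q (length vs)"
      using assms by (auto simp: field_vecs_def)
    ultimately show "x \<in> (\<lambda>c. lincomb q m c vs) ` field_vecs q (length vs)" by blast
  qed
qed (auto simp: vspan_def)

lemma card_vspan_le: "q > 0 \<Longrightarrow> card (vspan q m vs) \<le> q ^ length vs"
  by (metis vspan_eq_image card_field_vecs card_image_le finite_field_vecs)

lemma finite_vspan: "q > 0 \<Longrightarrow> finite (vspan q m vs)"
  by (simp add: vspan_eq_image finite_field_vecs)

lemma in_vspan_if_in_set:
  assumes "x \<in> set vs" "x \<in> field_vecs q m"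
  shows "x \<in> vspan q m vs"
proof -
  obtain i where i: "i < length vs" "x = vs ! i"
    using assms(1) by (auto simp: in_set_conv_nth)
  have "(\<Sum>l<length vs. (if l = i then 1 else 0) * (vs ! l) j) = x j" for j
    using i by (simp add: if_distrib[where f = "\<lambda>c. c * _"] sum.delta cong: if_cong)
  then have "lincomb q m (\<lambda>l. if l = i then 1 else 0) vs = x"
    using assms(2) by (auto simp: lincomb_def field_vecs_def fun_eq_iff PiE_def Pi_def extensional_def)
  then show ?thesis by (auto simp: vspan_def)
qed

lemma lincomb_in_vspan:
  assumes "set bs \<subseteq> vspan q m vs"
  shows "lincomb q m c bs \<in> vspan q m vs"
proof -
  have "\<forall>i<length bs. \<exists>b. bs ! i = lincomb q m b vs"
    using assms by (force simp: vspan_def)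
  then obtain b where b: "\<And>i. i < length bs \<Longrightarrow> bs ! i = lincomb q m (b i) vs"
    by metis
  have "lincomb q m c bs j = lincomb q m (\<lambda>l. \<Sum>i<length bs. c i * b i l) vs j" for j
  proof (cases "j < m")
    case True
    have "lincomb q m c bs j =
        (\<Sum>i<length bs. (c i * (bs ! i) j) mod int q) mod int q"
      using True by (simp add: lincomb_def mod_sum_eq)
    also have "\<dots> = (\<Sum>i<length bs. (c i * (\<Sum>l<length vs. b i l * (vs ! l) j)) mod int q) mod int q"
      using True by (simp add: b lincomb_def mod_mult_right_eq)
    also have "\<dots> = (\<Sum>i<length bs. c i * (\<Sum>l<length vs. b i l * (vs ! l) j)) mod int q"
      by (rule mod_sum_eq)
    also have "(\<Sum>i<length bs. c i * (\<Sum>l<length vs. b i l * (vs ! l) j)) =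
        (\<Sum>l<length vs. (\<Sum>i<length bs. c i * b i l) * (vs ! l) j)"
      unfolding sum_distrib_left sum_distrib_right
      by (subst sum.swap) (simp add: mult.assoc)
    finally show ?thesis using True by (simp add: lincomb_def)
  qed (simp add: lincomb_def)
  then show ?thesis by (auto simp: vspan_def)
qed

lemma vspan_mono: "set bs \<subseteq> vspan q m vs \<Longrightarrow> vspan q m bs \<subseteq> vspan q m vs"
  by (subst vspan_def) (auto intro: lincomb_in_vspan)

lemma prime_int_inverse:
  assumes "prime q" "(a::int) mod int q \<noteq> 0"
  obtains e where "(e * a) mod int q = 1"
proof -
  have "coprime a (int q)"
    using assms prime_imp_coprime[of "int q" a] by (auto simp: coprime_commute dvd_eq_mod_eq_0)
  then obtain e v where ev: "e * a + v * int q = 1"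
    using bezout_int[of a "int q"] by auto
  have "(e * a) mod int q = (e * a + v * int q) mod int q" by simp
  also have "\<dots> = 1"
    using prime_gt_1_nat[OF assms(1)] by (simp add: ev)
  finally show ?thesis by (rule that)
qed

text \<open>A linear relation in which \<open>x\<close> has an invertible coefficient can be solved
  for \<open>x\<close>.\<close>

lemma in_vspan_if_coeff_nonzero:
  assumes q: "prime q" and x: "x \<in> field_vecs q m"
    and eq: "\<And>j. j < m \<Longrightarrow> ((\<Sum>i<length bs. g i * (bs ! i) j) + a * x j) mod int q = 0"
    and a: "a mod int q \<noteq> 0"
  shows "x \<in> vspan q m bs"
proof -
  obtain e where e: "(e * a) mod int q = 1"
    using prime_int_inverse[OF q a] .
  have "x j = lincomb q m (\<lambda>i. - e * g i) bs j" for j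
  proof (cases "j < m")
    case True
    define S where "S = (\<Sum>i<length bs. g i * (bs ! i) j)"
    have "int q dvd S + a * x j"
      using eq[OF True] by (simp add: S_def dvd_eq_mod_eq_0)
    then have "int q dvd e * (S + a * x j)" by simp
    moreover have "int q dvd e * a - 1"
      using e prime_gt_1_nat[OF q] by (metis mod_eq_dvd_iff mod_pos_pos_trivial nat_less_iff
          of_nat_1 of_nat_less_iff zero_less_one less_eq_int_code(1) zero_le_one)
    then have "int q dvd (e * a - 1) * x j" by simp
    \<comment> \<open>The terms \<open>e * a * x j\<close> cancel, and \<open>x j + e * S\<close>
      remains.\<close>
    ultimately have "int q dvd e * (S + a * x j) - (e * a - 1) * x j" by (rule dvd_diff)
    then have "int q dvd x j - (- e * S)" by (simp add: algebra_simps)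
    then have "x j mod int q = (- e * S) mod int q" by (simp add: mod_eq_dvd_iff)
    moreover have "x j mod int q = x j"
      using x True by (auto simp: field_vecs_def PiE_def Pi_def)
    ultimately show ?thesis
      using True by (simp add: lincomb_def S_def sum_distrib_left mult.assoc sum_negf)
  qed (use x in \<open>auto simp: lincomb_def field_vecs_def PiE_def extensional_def\<close>)
  then show ?thesis by (auto simp: vspan_def)
qed

text \<open>Linear independence of the innovative vectors. The difference of two equal combinations
  is a relation; a nonzero last coefficient would put the last vector into the span of its
  predecessors. So the last coefficients agree, and the induction hypothesis settles the
  others.\<close>

lemma inj_on_lincomb_innovative:
  assumes "prime q" "set vs \<subseteq> field_vecs q m"
  shows "inj_on (\<lambda>c. lincomb q m c (innovative q m vs))
           (field_vecs q (length (innovative q m vs)))"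
  using assms(2)
proof (induction vs rule: rev_induct)
  case Nil
  then show ?case by (auto simp: innovative_Nil field_vecs_def inj_on_def)
next
  case (snoc x vs)
  define bs where "bs = innovative q m vs"
  have IH: "inj_on (\<lambda>c. lincomb q m c bs) (field_vecs q (length bs))"
    using snoc by (simp add: bs_def)
  have x: "x \<in> field_vecs q m" using snoc.prems by simp
  have "inj_on (\<lambda>c. lincomb q m c (bs @ [x])) (field_vecs q (length (bs @ [x])))"
    if nin: "x \<notin> vspan q m bs"
  proof (rule inj_onI)
    fix c c'
    assume c: "c \<in> field_vecs q (length (bs @ [x]))" "c' \<in> field_vecs q (length (bs @ [x]))"
      and eq: "lincomb q m c (bs @ [x]) = lincomb q m c' (bs @ [x])"
    let ?l = "length bs"
    have split: "lincomb q m b (bs @ [x]) j =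
        ((\<Sum>i<?l. b i * (bs ! i) j) + b ?l * x j) mod int q" if "j < m" for b j
    proof -
      have "(\<Sum>i<?l. b i * ((bs @ [x]) ! i) j) = (\<Sum>i<?l. b i * (bs ! i) j)"
        by (intro sum.cong) (auto simp: nth_append)
      then show ?thesis using that by (simp add: lincomb_def)
    qed
    have diff: "((\<Sum>i<?l. (c i - c' i) * (bs ! i) j) + (c ?l - c' ?l) * x j) mod int q = 0"
      if "j < m" for j
    proof -
      have "((\<Sum>i<?l. c i * (bs ! i) j) + c ?l * x j) mod int q
          = ((\<Sum>i<?l. c' i * (bs ! i) j) + c' ?l * x j) mod int q"
        using eq that by (metis split)
      then have "int q dvd ((\<Sum>i<?l. c i * (bs ! i) j) + c ?l * x j)
          - ((\<Sum>i<?l. c' i * (bs ! i) j) + c' ?l * x j)"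
        by (simp add: mod_eq_dvd_iff)
      also have "\<dots> = (\<Sum>i<?l. (c i - c' i) * (bs ! i) j) + (c ?l - c' ?l) * x j"
        by (simp add: algebra_simps sum_subtractf)
      finally show ?thesis by (simp add: dvd_eq_mod_eq_0)
    qed
    have "(c ?l - c' ?l) mod int q = 0"
      using in_vspan_if_coeff_nonzero[OF assms(1) x diff] nin by blast
    moreover have rng: "c i \<in> {0..<int q}" "c' i \<in> {0..<int q}" if "i \<le> ?l" for i
      using c that by (auto simp: field_vecs_def PiE_def Pi_def)
    ultimately have last: "c ?l = c' ?l"
      using rng[of ?l] by (metis atLeastLessThan_iff eq_iff_diff_eq_0 mod_eq_dvd_iff mod_pos_pos_trivial dvd_eq_mod_eq_0 order_refl)
    have "lincomb q m (restrict c {..<?l}) bs = lincomb q m (restrict c' {..<?l}) bs"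
    proof
      fix j
      show "lincomb q m (restrict c {..<?l}) bs j = lincomb q m (restrict c' {..<?l}) bs j"
      proof (cases "j < m")
        case True
        have "int q dvd (\<Sum>i<?l. c i * (bs ! i) j) - (\<Sum>i<?l. c' i * (bs ! i) j)"
          using diff[OF True] last
          by (simp add: algebra_simps sum_subtractf dvd_eq_mod_eq_0)
        then show ?thesis by (simp add: lincomb_def mod_eq_dvd_iff)
      qed (simp add: lincomb_def)
    qed
    moreover have "restrict c {..<?l} \<in> field_vecs q ?l" "restrict c' {..<?l} \<in> field_vecs q ?l"
      using rng by (auto simp: field_vecs_def)
    ultimately have "restrict c {..<?l} = restrict c' {..<?l}"
      using IH by (auto dest: inj_onD)
    then have "c i = c' i" if "i < ?l" for i
      using that by (metis restrict_apply' lessThan_iff)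
    then have "c i = c' i" if "i < Suc ?l" for i
      using that last by (auto simp: less_Suc_eq)
    moreover have "c i = c' i" if "\<not> i < Suc ?l" for i
      using that c by (auto simp: field_vecs_def PiE_def extensional_def)
    ultimately show "c = c'" by blast
  qed
  with IH show ?case
    unfolding innovative_snoc bs_def[symmetric] by (cases "x \<in> vspan q m bs") simp_all
qed

lemma card_vspan_innovative:
  assumes "prime q" "set vs \<subseteq> field_vecs q m"
  shows "card (vspan q m (innovative q m vs)) = q ^ length (innovative q m vs)"
  by (simp add: vspan_eq_image[OF prime_gt_0_nat[OF assms(1)]]
      card_image[OF inj_on_lincomb_innovative[OF assms]] card_field_vecs)

text \<open>Counting takes the place of an exchange argument: independent vectors span exactly
  \<open>q\<close> to the power of their number, inside a span of at most
  \<open>q ^ length ts\<close> elements.\<close>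

lemma length_innovative_le:
  assumes "prime q" "set vs \<subseteq> vspan q m ts"
  shows "length (innovative q m vs) \<le> length ts"
proof -
  note q = prime_gt_0_nat[OF assms(1)]
  have "q ^ length (innovative q m vs) = card (vspan q m (innovative q m vs))"
    using assms vspan_subset_field_vecs[OF q] by (intro card_vspan_innovative[symmetric]) auto
  also have "\<dots> \<le> card (vspan q m ts)"
    by (intro card_mono finite_vspan q vspan_mono)
      (use assms set_innovative_subset in fast)
  also have "\<dots> \<le> q ^ length ts" by (rule card_vspan_le[OF q])
  finally show ?thesis using prime_gt_1_nat[OF assms(1)] by simp
qed

section \<open>Functionals on the coefficient coordinates\<close>

text \<open>Only the first \<open>k\<close> coordinates of \<open>y\<close> enter. For
  \<open>y\<close> in the span of the token vectors they are the coefficients modulo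
  \<open>q\<close> with respect to these vectors, so \<open>\<mu>\<close> acts as a functional on
  coefficients.\<close>

definition dot :: "nat \<Rightarrow> nat \<Rightarrow> fvec \<Rightarrow> fvec \<Rightarrow> int" where
  "dot q k \<mu> y = (\<Sum>j<k. \<mu> j * y j) mod int q"

lemma dot_range: "q > 0 \<Longrightarrow> dot q k \<mu> y \<in> {0..<int q}"
  by (simp add: dot_def)

lemma dot_lincomb:
  assumes "k \<le> m"
  shows "dot q k \<mu> (lincomb q m c vs) = (\<Sum>i<length vs. c i * dot q k \<mu> (vs ! i)) mod int q"
proof -
  have "dot q k \<mu> (lincomb q m c vs) =
      (\<Sum>j<k. (\<mu> j * (\<Sum>i<length vs. c i * (vs ! i) j)) mod int q) mod int q"
  proof -
    have "dot q k \<mu> (lincomb q m c vs) =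
        (\<Sum>j<k. (\<mu> j * lincomb q m c vs j) mod int q) mod int q"
      unfolding dot_def by (rule mod_sum_eq[symmetric])
    moreover have "(\<mu> j * lincomb q m c vs j) mod int q =
        (\<mu> j * (\<Sum>i<length vs. c i * (vs ! i) j)) mod int q" if "j < k" for j
      using that assms by (simp add: lincomb_def mod_mult_right_eq)
    ultimately show ?thesis by simp
  qed
  also have "\<dots> = (\<Sum>j<k. \<mu> j * (\<Sum>i<length vs. c i * (vs ! i) j)) mod int q"
    by (rule mod_sum_eq)
  also have "(\<Sum>j<k. \<mu> j * (\<Sum>i<length vs. c i * (vs ! i) j)) =
      (\<Sum>i<length vs. c i * (\<Sum>j<k. \<mu> j * (vs ! i) j))"
    unfolding sum_distrib_left by (subst sum.swap) (simp add: mult.left_commute)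
  also have "\<dots> mod int q = (\<Sum>i<length vs. (c i * (\<Sum>j<k. \<mu> j * (vs ! i) j)) mod int q) mod int q"
    by (rule mod_sum_eq[symmetric])
  also have "\<dots> = (\<Sum>i<length vs. (c i * dot q k \<mu> (vs ! i)) mod int q) mod int q"
    by (simp add: dot_def mod_mult_right_eq)
  also have "\<dots> = (\<Sum>i<length vs. c i * dot q k \<mu> (vs ! i)) mod int q"
    by (rule mod_sum_eq)
  finally show ?thesis .
qed

lemma dot_lincomb_nonzeroD:
  assumes "k \<le> m" "dot q k \<mu> (lincomb q m c vs) \<noteq> 0"
  shows "\<exists>b\<in>set vs. dot q k \<mu> b \<noteq> 0"
proof (rule ccontr)
  assume "\<not> ?thesis"
  then have "(\<Sum>i<length vs. c i * dot q k \<mu> (vs ! i)) = 0"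
    by (intro sum.neutral) auto
  with assms show False by (simp add: dot_lincomb)
qed

definition dual_vecs :: "nat \<Rightarrow> nat \<Rightarrow> fvec set" where
  "dual_vecs q k = {\<mu> \<in> field_vecs q k. \<exists>j<k. \<mu> j \<noteq> 0}"

text \<open>With fewer than \<open>k\<close> vectors, two different \<open>\<mu>\<close> have the same inner products with all of them, and
  their difference is orthogonal to all of them.\<close>

lemma exists_orthogonal:
  assumes q: "prime q" and l: "length bs < k"
  obtains \<mu> where "\<mu> \<in> dual_vecs q k" "\<And>b. b \<in> set bs \<Longrightarrow> dot q k \<mu> b = 0"
proof -
  have q0: "q > 0" using q by (rule prime_gt_0_nat)
  define f where "f = (\<lambda>\<mu>. \<lambda>i\<in>{..<length bs}. dot q k \<mu> (bs ! i))"
  have "f ` field_vecs q k \<subseteq> field_vecs q (length bs)"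
    using dot_range[OF q0] unfolding f_def field_vecs_def by (intro image_subsetI restrict_PiE_iff[THEN iffD2]) simp
  then have "card (f ` field_vecs q k) \<le> q ^ length bs"
    by (metis card_mono finite_field_vecs card_field_vecs)
  also have "\<dots> < card (field_vecs q k)"
    using l prime_gt_1_nat[OF q] by (simp add: card_field_vecs)
  finally have "\<not> inj_on f (field_vecs q k)"
    by (rule pigeonhole)
  then obtain \<mu> \<nu> where mn: "\<mu> \<in> field_vecs q k" "\<nu> \<in> field_vecs q k" "\<mu> \<noteq> \<nu>" "f \<mu> = f \<nu>"
    by (auto simp: inj_on_def)
  define \<delta> where "\<delta> = (\<lambda>j\<in>{..<k}. (\<mu> j - \<nu> j) mod int q)"
  obtain j where j: "\<mu> j \<noteq> \<nu> j" using mn by blast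
  have "j < k" using j mn by (auto simp: field_vecs_def PiE_def extensional_def)
  moreover have "\<delta> j \<noteq> 0"
  proof
    assume "\<delta> j = 0"
    then have "\<mu> j mod int q = \<nu> j mod int q"
      using \<open>j < k\<close> by (simp add: \<delta>_def mod_eq_dvd_iff dvd_eq_mod_eq_0)
    then show False using mn j \<open>j < k\<close> by (auto simp: field_vecs_def PiE_def Pi_def)
  qed
  moreover have "\<delta> \<in> field_vecs q k" using q0 by (auto simp: \<delta>_def field_vecs_def)
  moreover have "dot q k \<delta> b = 0" if "b \<in> set bs" for b
  proof -
    obtain i where i: "i < length bs" "b = bs ! i" using \<open>b \<in> set bs\<close> by (auto simp: in_set_conv_nth)
    have "dot q k \<mu> b = dot q k \<nu> b"
      using mn(4) i by (metis f_def restrict_apply' lessThan_iff)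
    then have "int q dvd (\<Sum>j<k. (\<mu> j - \<nu> j) * b j)"
      by (simp add: dot_def mod_eq_dvd_iff algebra_simps sum_subtractf)
    moreover have "dot q k \<delta> b = (\<Sum>j<k. (\<mu> j - \<nu> j) * b j) mod int q"
    proof -
      have "dot q k \<delta> b = (\<Sum>j<k. (\<delta> j * b j) mod int q) mod int q"
        unfolding dot_def by (rule mod_sum_eq[symmetric])
      also have "\<dots> = (\<Sum>j<k. ((\<mu> j - \<nu> j) * b j) mod int q) mod int q"
        by (simp add: \<delta>_def mod_mult_left_eq)
      finally show ?thesis by (simp only: mod_sum_eq)
    qed
    ultimately show ?thesis by (simp add: dvd_eq_mod_eq_0)
  qed
  ultimately show ?thesis using that by (auto simp: dual_vecs_def)
qed

text \<open>Fewer than \<open>k\<close> innovative vectors would all be orthogonal to some nonzero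
  \<open>\<mu>\<close>, against \<open>sense\<close>. Hence their span has at least
  \<open>q ^ k\<close> elements, the most that \<open>k\<close> vectors can span.\<close>

lemma vspan_innovative_full:
  assumes q: "prime q" and vs: "set vs \<subseteq> vspan q m ts" and ts: "length ts = k"
    and sense: "\<And>\<mu>. \<mu> \<in> dual_vecs q k \<Longrightarrow> \<exists>b\<in>set (innovative q m vs). dot q k \<mu> b \<noteq> 0"
  shows "vspan q m (innovative q m vs) = vspan q m ts"
proof (rule card_subset_eq)
  note q0 = prime_gt_0_nat[OF q]
  show "finite (vspan q m ts)" using q0 by (rule finite_vspan)
  show sub: "vspan q m (innovative q m vs) \<subseteq> vspan q m ts"
    by (rule vspan_mono) (use vs set_innovative_subset in fast)
  have "\<not> length (innovative q m vs) < k"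
    using exists_orthogonal[OF q] sense by metis
  then have "q ^ length ts \<le> card (vspan q m (innovative q m vs))"
    using ts vs vspan_subset_field_vecs[OF q0] q0
    by (subst card_vspan_innovative[OF q]) (auto intro!: power_increasing)
  then show "card (vspan q m (innovative q m vs)) = card (vspan q m ts)"
    using card_mono[OF finite_vspan[OF q0] sub] card_vspan_le[OF q0, of m ts] by simp
qed


section \<open>Bad rounds for a fixed list of innovative transmissions\<close>

text \<open>Conditioning on the past: \<open>p\<close> draws the past \<open>x\<close>, and
  \<open>f x\<close> is the law of what follows. The event \<open>A\<close> is impossible for pasts
  outside \<open>E\<close> and has probability at most \<open>c\<close> for the others.\<close>

lemma prob_bind_pmf_le:
  assumes "\<And>x. x \<in> set_pmf p \<Longrightarrow> measure_pmf.prob (f x) A \<le> c * indicator E x" "c \<ge> 0"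
  shows "measure_pmf.prob (bind_pmf p f) A \<le> c * measure_pmf.prob p E"
proof -
  have "ennreal (measure_pmf.prob (bind_pmf p f) A) = (\<integral>\<^sup>+x. ennreal (measure_pmf.prob (f x) A) \<partial>p)"
    by (simp flip: measure_pmf.emeasure_eq_measure)
  also have "\<dots> \<le> (\<integral>\<^sup>+x. ennreal c * indicator E x \<partial>p)"
    using assms
    by (intro nn_integral_mono_AE)
      (auto simp: AE_measure_pmf_iff simp flip: ennreal_indicator ennreal_mult intro!: ennreal_leI)
  also have "\<dots> = ennreal (c * measure_pmf.prob p E)"
    using assms(2)
    by (simp add: nn_integral_cmult_indicator measure_pmf.emeasure_eq_measure ennreal_mult)
  finally show ?thesis using assms(2) by simp
qed

text \<open>Draw all other coordinates first. Given them, at most one of the \<open>q\<close>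
  equally likely values at \<open>x\<close> leads into \<open>A\<close>.\<close>

lemma prob_Pi_pmf_unique_coordinate:
  assumes "finite S" "x \<in> S" "q > 0"
    and unique: "\<And>g a b. \<lbrakk>a \<in> {0..<int q}; b \<in> {0..<int q}; g(x := a) \<in> A; g(x := b) \<in> A\<rbrakk> \<Longrightarrow> a = b"
  shows "measure_pmf.prob (Pi_pmf S 0 (\<lambda>_. pmf_of_set {0..<int q})) A \<le> 1 / real q"
proof -
  let ?U = "pmf_of_set {0..<int q}"
  have "Pi_pmf S 0 (\<lambda>_. ?U) = Pi_pmf (insert x (S - {x})) 0 (\<lambda>_. ?U)"
    using assms(2) by (simp add: insert_absorb)
  also have "\<dots> = do {y \<leftarrow> ?U; g \<leftarrow> Pi_pmf (S - {x}) 0 (\<lambda>_. ?U); return_pmf (g(x := y))}"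
    using assms(1) by (intro Pi_pmf_insert') auto
  also have "\<dots> = do {g \<leftarrow> Pi_pmf (S - {x}) 0 (\<lambda>_. ?U); map_pmf (\<lambda>y. g(x := y)) ?U}"
    by (subst bind_commute_pmf) (simp add: map_pmf_def)
  finally have eq: "Pi_pmf S 0 (\<lambda>_. ?U) = \<dots>" .
  have "measure_pmf.prob (map_pmf (\<lambda>y. g(x := y)) ?U) A \<le> 1 / real q * indicator UNIV g" for g
  proof -
    let ?B = "{0..<int q} \<inter> {y. g(x := y) \<in> A}"
    have "card ?B \<le> 1"
      using unique by (auto simp: card_le_Suc0_iff_eq)
    moreover have "measure_pmf.prob (map_pmf (\<lambda>y. g(x := y)) ?U) A = card ?B / real q"
      using assms(3) by (simp add: measure_pmf_of_set vimage_def)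
    ultimately show ?thesis by (simp add: divide_right_mono)
  qed
  then have "measure_pmf.prob (Pi_pmf S 0 (\<lambda>_. ?U)) A \<le>
      1 / real q * measure_pmf.prob (Pi_pmf (S - {x}) 0 (\<lambda>_. ?U)) UNIV"
    unfolding eq by (intro prob_bind_pmf_le) auto
  then show ?thesis by simp
qed

text \<open>Splits off the coins of the last round. Joining them by a test of the round alone makes
  \<open>replay_cong\<close> applicable to the joined coins.\<close>

lemma coin_pmf_Suc:
  "coin_pmf q n k (Suc T) =
     do {f \<leftarrow> coin_pmf q n k T;
         map_pmf (\<lambda>g x. if fst x < T then f x else g x)
           (Pi_pmf ({T} \<times> {..<n} \<times> {..<k}) 0 (\<lambda>_. pmf_of_set {0..<int q}))}"
proof -
  let ?U = "\<lambda>_. pmf_of_set {0..<int q}"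
  let ?A = "{..<T} \<times> {..<n} \<times> {..<k}" and ?B = "{T} \<times> {..<n} \<times> {..<k}"
  have "coin_pmf q n k (Suc T) = Pi_pmf (?A \<union> ?B) 0 ?U"
    unfolding coin_pmf_def by (rule arg_cong[where f = "\<lambda>S. Pi_pmf S 0 ?U"]) auto
  also have "\<dots> = map_pmf (\<lambda>(f, g) x. if x \<in> ?A then f x else g x) (pair_pmf (Pi_pmf ?A 0 ?U) (Pi_pmf ?B 0 ?U))"
    by (rule Pi_pmf_union) auto
  \<comment> \<open>Both parts take the default \<open>0\<close> outside their index sets, so the
    two tests differ only where both values are \<open>0\<close>.\<close>
  also have "\<dots> = map_pmf (\<lambda>(f, g) x. if fst x < T then f x else g x) (pair_pmf (Pi_pmf ?A 0 ?U) (Pi_pmf ?B 0 ?U))"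
  proof (rule map_pmf_cong[OF refl], clarsimp, rule ext)
    fix f g :: "nat \<times> nat \<times> nat \<Rightarrow> int" and x
    assume "f \<in> set_pmf (Pi_pmf ?A 0 ?U)" "g \<in> set_pmf (Pi_pmf ?B 0 ?U)"
    moreover have "set_pmf (Pi_pmf ?A 0 ?U) \<subseteq> {f. \<forall>x. x \<notin> ?A \<longrightarrow> f x = 0}"
      and "set_pmf (Pi_pmf ?B 0 ?U) \<subseteq> {f. \<forall>x. x \<notin> ?B \<longrightarrow> f x = 0}"
      by (rule set_Pi_pmf_subset; simp)+
    ultimately have "x \<notin> ?A \<longrightarrow> f x = 0" "x \<notin> ?B \<longrightarrow> g x = 0"
      by blast+
    then show "(if x \<in> ?A then f x else g x) = (if fst x < T then f x else g x)"
      by (cases x) auto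
  qed
  finally show ?thesis
    by (simp add: pair_pmf_def map_bind_pmf coin_pmf_def map_pmf_def bind_assoc_pmf bind_return_pmf)
qed

text \<open>
  Given which of the transmissions were innovative for each node (a pair \<open>(t, w)\<close> in \<open>W u\<close> is the
  message of \<open>w\<close> in round \<open>t\<close>), the bases held by the nodes are determined by the coins of the
  earlier rounds, without reference to the graphs.
\<close>

primrec replay :: "nat \<Rightarrow> nat \<Rightarrow> (nat \<Rightarrow> fvec list) \<Rightarrow> (nat \<Rightarrow> (nat \<times> nat) list) \<Rightarrow> coins \<Rightarrow>
    nat \<Rightarrow> nat \<Rightarrow> fvec list" where
  "replay q m B W \<omega> 0 u = B u"
| "replay q m B W \<omega> (Suc t) u = replay q m B W \<omega> t u @
     map (\<lambda>p. lincomb q m (\<lambda>j. \<omega> (t, snd p, j)) (replay q m B W \<omega> t (snd p)))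
       (filter (\<lambda>p. fst p = t) (W u))"

text \<open>The coins of round \<open>t\<close> are thus fresh given the replayed bases of round
  \<open>t\<close>.\<close>

lemma replay_cong:
  assumes "\<And>x. fst x < t \<Longrightarrow> \<omega> x = \<omega>' x"
  shows "replay q m B W \<omega> t u = replay q m B W \<omega>' t u"
  using assms
proof (induction t arbitrary: u)
  case (Suc t)
  then have "replay q m B W \<omega> t v = replay q m B W \<omega>' t v" for v by simp
  with Suc.prems show ?case by simp
qed simp

text \<open>The bases \<open>L\<close> are a parameter because both the bases of an execution and
  replayed ones are meant. The bound \<open>j < k\<close> reflects that a node has only
  \<open>k\<close> random coins per round, while replayed lists for arbitrary \<open>W\<close> may
  be longer.\<close>

definition bad_round :: "nat \<Rightarrow> nat \<Rightarrow> nat \<Rightarrow> nat \<Rightarrow> fvec \<Rightarrow> (nat \<Rightarrow> nat \<Rightarrow> fvec list) \<Rightarrow>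
    coins \<Rightarrow> nat \<Rightarrow> bool" where
  "bad_round q m n k \<mu> L \<omega> t \<longleftrightarrow>
     (\<exists>u<n. (\<exists>j<k. j < length (L t u) \<and> dot q k \<mu> (L t u ! j) \<noteq> 0) \<and>
        dot q k \<mu> (lincomb q m (\<lambda>j. \<omega> (t, u, j)) (L t u)) = 0)"

text \<open>With the other coins fixed, the inner product is affine in coin \<open>j\<close>, and
  its slope \<open>dot q k \<mu> (bs ! j)\<close> is invertible modulo \<open>q\<close>. So at most
  one value of that coin makes it vanish.\<close>

lemma prob_message_orthogonal_le:
  fixes t u n :: nat
  assumes q: "prime q" and "k \<le> m" "u < n" "j < k" "j < length bs" "dot q k \<mu> (bs ! j) \<noteq> 0"
  shows "measure_pmf.prob (Pi_pmf ({t} \<times> {..<n} \<times> {..<k}) 0 (\<lambda>_. pmf_of_set {0..<int q}))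
      {g. dot q k \<mu> (lincomb q m (\<lambda>j. g (t, u, j)) bs) = 0} \<le> 1 / real q"
proof (rule prob_Pi_pmf_unique_coordinate[where x = "(t, u, j)"])
  fix g :: coins and a b
  let ?d = "\<lambda>i. dot q k \<mu> (bs ! i)"
  assume ab: "a \<in> {0..<int q}" "b \<in> {0..<int q}"
    and mem: "g((t, u, j) := a) \<in> {g. dot q k \<mu> (lincomb q m (\<lambda>j. g (t, u, j)) bs) = 0}"
      "g((t, u, j) := b) \<in> {g. dot q k \<mu> (lincomb q m (\<lambda>j. g (t, u, j)) bs) = 0}"
  define R where "R = (\<Sum>i\<in>{..<length bs} - {j}. g (t, u, i) * ?d i)"
  have sum: "(\<Sum>i<length bs. (g((t, u, j) := y)) (t, u, i) * ?d i) = y * ?d j + R" for y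
  proof -
    have "(\<Sum>i\<in>{..<length bs} - {j}. (g((t, u, j) := y)) (t, u, i) * ?d i) = R"
      unfolding R_def by (intro sum.cong) auto
    then show ?thesis using assms(5) by (subst sum.remove[of _ j]) auto
  qed
  have "(y * ?d j + R) mod int q = 0"
    if "g((t, u, j) := y) \<in> {g. dot q k \<mu> (lincomb q m (\<lambda>j. g (t, u, j)) bs) = 0}" for y
    using that unfolding mem_Collect_eq dot_lincomb[OF assms(2)] sum .
  then have "(a * ?d j + R) mod int q = (b * ?d j + R) mod int q"
    using mem by metis
  then have "int q dvd (a - b) * ?d j"
    by (simp add: mod_eq_dvd_iff algebra_simps)
  moreover have "\<not> int q dvd ?d j"
    using assms(6) dot_range[OF prime_gt_0_nat[OF q], of k \<mu> "bs ! j"] by (auto dest: zdvd_imp_le)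
  ultimately have "int q dvd a - b"
    using q by (simp add: prime_dvd_mult_iff)
  then have "a mod int q = b mod int q" by (simp add: mod_eq_dvd_iff)
  then show "a = b" using ab by simp
qed (use assms prime_gt_0_nat in auto)

text \<open>Induction over rounds. Given the coins before round \<open>T\<close>, the replayed bases
  of that round are fixed, and a union over the \<open>n\<close> nodes gives a factor
  \<open>n / q\<close> if \<open>T \<in> R\<close>. Here \<open>\<mu>\<close>, \<open>W\<close> and
  \<open>R\<close> are fixed in advance of the coins.\<close>

lemma prob_bad_rounds_le:
  assumes q: "prime q" and km: "k \<le> m" and "R \<subseteq> {..<T}"
  shows "measure_pmf.prob (coin_pmf q n k T)
      {\<omega>. \<forall>t\<in>R. bad_round q m n k \<mu> (replay q m B W \<omega>) \<omega> t} \<le> (real n / real q) ^ card R"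
  using assms(3)
proof (induction T arbitrary: R)
  case 0
  then show ?case by simp
next
  case (Suc T)
  let ?bad = "\<lambda>\<omega>. bad_round q m n k \<mu> (replay q m B W \<omega>) \<omega>"
  let ?P = "Pi_pmf ({T} \<times> {..<n} \<times> {..<k}) 0 (\<lambda>_. pmf_of_set {0..<int q})"
  let ?join = "\<lambda>f g x. if fst x < T then f x else (g x :: int)"
  let ?A = "{\<omega>. \<forall>t\<in>R. ?bad \<omega> t}"
  define R' where "R' = R - {T}"
  have R': "R' \<subseteq> {..<T}" using Suc.prems by (auto simp: R'_def)
  define E where "E = {\<omega>. \<forall>t\<in>R'. ?bad \<omega> t}"
  have rep: "replay q m B W (?join f g) t = replay q m B W f t" if "t \<le> T" for f g t
    by (rule ext, rule replay_cong) (use that in auto)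
  have bad: "?bad (?join f g) t \<longleftrightarrow> ?bad f t" if "t < T" for f g t
    using that by (simp add: bad_round_def rep)
  have E: "f \<in> E" if "?join f g \<in> ?A" for f g
  proof -
    have "?bad f t" if t: "t \<in> R'" for t
    proof -
      have "?bad (?join f g) t" using \<open>?join f g \<in> ?A\<close> t by (simp add: R'_def)
      then show ?thesis using bad R' t by blast
    qed
    then show ?thesis by (simp add: E_def)
  qed
  define c where "c = (if T \<in> R then real n / real q else 1)"
  have "measure_pmf.prob (map_pmf (?join f) ?P) ?A \<le> c * indicator E f" for f
  proof (cases "f \<in> E")
    \<comment> \<open>If some earlier round of \<open>R\<close> is not bad, the coins of round
      \<open>T\<close> cannot change that.\<close>
    case False
    then have "?join f -` ?A = {}" using E by blast
    then have "measure_pmf.prob (map_pmf (?join f) ?P) ?A = 0"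
      unfolding measure_map_pmf by (simp only: measure_empty)
    then show ?thesis using False by simp
  next
    case True
    show ?thesis
    proof (cases "T \<in> R")
      case T: True
      let ?L = "replay q m B W f T"
      let ?D = "\<lambda>u. {g. dot q k \<mu> (lincomb q m (\<lambda>j. g (T, u, j)) (?L u)) = 0}"
      let ?V = "{u. u < n \<and> (\<exists>j<k. j < length (?L u) \<and> dot q k \<mu> (?L u ! j) \<noteq> 0)}"
      have "?join f -` ?A \<subseteq> (\<Union>u\<in>?V. ?D u)"
        using T by (fastforce simp: bad_round_def rep)
      then have "measure_pmf.prob (map_pmf (?join f) ?P) ?A \<le> measure_pmf.prob ?P (\<Union>u\<in>?V. ?D u)"
        by (simp add: measure_pmf.finite_measure_mono)
      also have "\<dots> \<le> (\<Sum>u\<in>?V. measure_pmf.prob ?P (?D u))"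
        by (rule measure_UNION_le) auto
      also have "\<dots> \<le> (\<Sum>u\<in>?V. 1 / real q)"
        using prob_message_orthogonal_le[OF q km] by (intro sum_mono) blast
      also have "\<dots> \<le> (\<Sum>u<n. 1 / real q)"
        by (rule sum_mono2) auto
      finally show ?thesis using T True by (simp add: c_def)
    qed (simp add: c_def True)
  qed
  then have "measure_pmf.prob (coin_pmf q n k (Suc T)) ?A \<le> c * measure_pmf.prob (coin_pmf q n k T) E"
    unfolding coin_pmf_Suc by (intro prob_bind_pmf_le) (auto simp: c_def)
  also have "\<dots> \<le> c * (real n / real q) ^ card R'"
    using Suc.IH[OF R'] by (intro mult_left_mono) (auto simp: c_def E_def)
  also have "\<dots> = (real n / real q) ^ card R"
  proof (cases "T \<in> R")
    case True
    then have "card R = Suc (card R')"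
      using finite_subset[OF Suc.prems] unfolding R'_def by (intro card.remove) auto
    then show ?thesis using True by (simp add: c_def)
  qed (simp add: c_def R'_def)
  finally show ?case .
qed


section \<open>Executions\<close>

text \<open>Used with messages as \<open>f\<close> and neighbours as \<open>ws\<close>: the growth
  of a basis is recorded by the senders \<open>s\<close> of innovative messages, for which there are
  far fewer possibilities than for the messages themselves.\<close>

lemma innovative_append_map:
  "\<exists>s. set s \<subseteq> set ws \<and> innovative q m (vs @ map f ws) = innovative q m vs @ map f s"
proof (induction ws rule: rev_induct)
  case Nil
  show ?case by simp
next
  case (snoc w ws)
  then obtain s where s: "set s \<subseteq> set ws"
    "innovative q m (vs @ map f ws) = innovative q m vs @ map f s" by blast
  have "innovative q m (vs @ map f (ws @ [w])) = innovative q m ((vs @ map f ws) @ [f w])"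
    by simp
  also have "\<dots> = innovative q m vs @ map f s \<or> \<dots> = innovative q m vs @ map f (s @ [w])"
    unfolding innovative_snoc s(2) by simp
  finally have "innovative q m (vs @ map f (ws @ [w])) = innovative q m vs @ map f s \<or>
    innovative q m (vs @ map f (ws @ [w])) = innovative q m vs @ map f (s @ [w])" .
  then show ?case
  proof
    assume "innovative q m (vs @ map f (ws @ [w])) = innovative q m vs @ map f s"
    then show ?thesis using s(1) by (intro exI[of _ s]) auto
  next
    assume "innovative q m (vs @ map f (ws @ [w])) = innovative q m vs @ map f (s @ [w])"
    then show ?thesis using s(1) by (intro exI[of _ "s @ [w]"]) auto
  qed
qed

text \<open>A redundant vector is a combination of innovative ones, so a functional vanishing on
  these vanishes on it too. Passing to the basis loses no sensing.\<close>

lemma dot_innovative_nonzero: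
  assumes "k \<le> m" "x \<in> set vs" "dot q k \<mu> x \<noteq> 0"
  shows "\<exists>b\<in>set (innovative q m vs). dot q k \<mu> b \<noteq> 0"
  using assms(2)
proof (induction vs rule: rev_induct)
  case (snoc y vs)
  show ?case
  proof (cases "x \<in> set vs")
    case True
    then show ?thesis using snoc.IH by (auto simp: innovative_snoc)
  next
    case False
    then have y: "y = x" using snoc.prems by simp
    show ?thesis
    proof (cases "x \<in> vspan q m (innovative q m vs)")
      case True
      then obtain c where "x = lincomb q m c (innovative q m vs)" by (auto simp: vspan_def)
      then show ?thesis
        using dot_lincomb_nonzeroD[OF assms(1)] assms(3) True by (auto simp: innovative_snoc y)
    qed (use assms(3) in \<open>auto simp: innovative_snoc y\<close>)
  qed
qed simp

lemma rtrancl_leaves_set: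
  assumes "(v, v') \<in> E\<^sup>*" "v \<in> S" "v' \<notin> S"
  shows "\<exists>w u. (w, u) \<in> E \<and> w \<in> S \<and> u \<notin> S"
  using assms by (induction rule: rtrancl_induct) blast+

text \<open>Tagging with rounds lets \<open>replay\<close> recover the block of a single round from
  the concatenated list.\<close>

lemma filter_concat_map_Pair:
  "filter (\<lambda>p. fst p = t) (concat (map (\<lambda>t. map (Pair t) (f t)) [0..<T])) =
     (if t < T then map (Pair t) (f t) else [])"
  by (induction T) (auto simp: filter_map o_def less_Suc_eq)

lemma bad_round_cong:
  assumes "\<And>u. u < n \<Longrightarrow> L t u = L' t u"
  shows "bad_round q m n k \<mu> L \<omega> t \<longleftrightarrow> bad_round q m n k \<mu> L' \<omega> t"
  unfolding bad_round_def using assms by (intro ex_cong1) auto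

definition initial_basis :: "nat \<Rightarrow> nat \<Rightarrow> nat \<Rightarrow> (nat \<Rightarrow> fvec) \<Rightarrow> (nat \<Rightarrow> nat set) \<Rightarrow> nat \<Rightarrow> fvec list" where
  "initial_basis q k d tok I u =
     innovative q (vec_dim k d q) (map (tok_vec q k d tok) (sorted_list_of_set (I u)))"

text \<open>The pairs \<open>(T, w)\<close> serve as padding to length \<open>k\<close>: no replay of \<open>T\<close> rounds looks at them.\<close>

definition witnesses :: "nat \<Rightarrow> nat \<Rightarrow> nat \<Rightarrow> (nat \<Rightarrow> (nat \<times> nat) list) set" where
  "witnesses n k T = {..<n} \<rightarrow>\<^sub>E {xs. set xs \<subseteq> {..T} \<times> {..<n} \<and> length xs = k}"

lemma finite_witnesses: "finite (witnesses n k T)"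
  by (auto simp: witnesses_def intro!: finite_PiE finite_lists_length_eq)

lemma card_witnesses: "card (witnesses n k T) = (n * (T + 1)) ^ (k * n)"
proof -
  have "card {xs. set xs \<subseteq> {..T} \<times> {..<n} \<and> length xs = k} = (n * (T + 1)) ^ k"
    by (subst card_lists_length_eq) (auto simp: card_cartesian_product mult.commute)
  then show ?thesis by (simp add: witnesses_def card_PiE power_mult)
qed

text \<open>One outcome of the coins with the graphs chosen for it; all statements inside are
  deterministic. The dependence of the graphs on the coins enters only when \<open>G\<close> is
  instantiated with \<open>A \<omega>\<close>.\<close>

locale coding_execution =
  fixes q n k d :: nat and tok :: "nat \<Rightarrow> fvec" and I :: "nat \<Rightarrow> nat set"
    and \<omega> :: coins and G :: "nat \<Rightarrow> graph"
  assumes q: "prime q"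
    and inst: "broadcast_instance q n k d tok I"
    and connected: "always_connected n G"
begin

definition m where "m = vec_dim k d q"

definition tokens where "tokens = map (tok_vec q k d tok) [0..<k]"

abbreviation K where "K \<equiv> known q k d tok I \<omega> G"

definition basis where "basis t u = innovative q m (K t u)"

lemma q0: "q > 0" using q by (rule prime_gt_0_nat)

lemma k_le_m: "k \<le> m" by (simp add: m_def vec_dim_def)

lemma tok_vec_in_field_vecs:
  assumes "i < k"
  shows "tok_vec q k d tok i \<in> field_vecs q m"
proof -
  have "tok i \<in> {..<tok_dim d q} \<rightarrow>\<^sub>E {0..<int q}"
    using inst assms by (simp add: broadcast_instance_def field_vecs_def)
  then have "tok i (j - k) \<in> {0..<int q}" if "j < m" "\<not> j < k" for j
    using that by (intro PiE_mem[of "tok i" "{..<tok_dim d q}"]) (auto simp: m_def vec_dim_def)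
  then show ?thesis
    using prime_gt_1_nat[OF q] by (auto simp: field_vecs_def tok_vec_def m_def[symmetric])
qed

lemma in_edges_less: "(w, u) \<in> G t \<Longrightarrow> w < n \<and> u < n"
  using connected by (auto simp: always_connected_def connected_graph_def)

lemma set_in_edges: "set (sorted_list_of_set {w. (w, u) \<in> G t}) = {w. (w, u) \<in> G t}"
proof -
  have "finite {w. (w, u) \<in> G t}"
    by (rule finite_subset[of _ "{..<n}"]) (auto dest: in_edges_less)
  then show ?thesis by simp
qed

lemma known_subset_span:
  "u < n \<Longrightarrow> set (K t u) \<subseteq> vspan q m tokens"
proof (induction t arbitrary: u)
  case 0
  have I: "I u \<subseteq> {..<k}" using inst 0 by (simp add: broadcast_instance_def)
  have "tok_vec q k d tok i \<in> vspan q m tokens" if "i \<in> I u" for i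
    using that I by (intro in_vspan_if_in_set tok_vec_in_field_vecs) (auto simp: tokens_def)
  then show ?case using finite_subset[OF I] by auto
next
  case (Suc t)
  have "message q k d tok I \<omega> G t w \<in> vspan q m tokens" if "w < n" for w
    using Suc.IH[OF that] set_innovative_subset
    unfolding message_def m_def[symmetric] by (intro lincomb_in_vspan) blast
  then show ?case
    using Suc.IH[OF Suc.prems] in_edges_less
    by (auto simp: known_Suc_eq_messages set_in_edges simp del: known.simps)
qed

text \<open>Serves twice: the \<open>k\<close> coins per node and round cover every basis vector,
  and no node has more than \<open>k\<close> innovative transmissions.\<close>

lemma length_basis_le: "u < n \<Longrightarrow> length (basis t u) \<le> k"
  using length_innovative_le[OF q known_subset_span[of u t]] by (simp add: basis_def tokens_def)

lemma basis_Suc: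
  "\<exists>s. set s \<subseteq> {w. (w, u) \<in> G t} \<and>
       basis (Suc t) u = basis t u @ map (message q k d tok I \<omega> G t) s"
  unfolding basis_def known_Suc_eq_messages
  using innovative_append_map[of "sorted_list_of_set {w. (w, u) \<in> G t}"] by (simp add: set_in_edges)

lemma message_eq: "message q k d tok I \<omega> G t w = lincomb q m (\<lambda>j. \<omega> (t, w, j)) (basis t w)"
  by (simp add: message_def basis_def m_def)

text \<open>The senders of innovative messages, tagged with their rounds, suffice to rebuild all
  bases from the coins round by round.\<close>

lemma exists_witness:
  "\<exists>W\<in>witnesses n k T. \<forall>t\<le>T. \<forall>u<n.
     replay q m (initial_basis q k d tok I) W \<omega> t u = basis t u"
proof -
  have "\<forall>t u. \<exists>s. set s \<subseteq> {w. (w, u) \<in> G t} \<and>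
      basis (Suc t) u = basis t u @ map (message q k d tok I \<omega> G t) s"
    using basis_Suc by blast
  then obtain s where s: "\<And>t u. set (s t u) \<subseteq> {w. (w, u) \<in> G t}"
    and basis: "\<And>t u. basis (Suc t) u = basis t u @ map (message q k d tok I \<omega> G t) (s t u)"
    by metis
  define W' where "W' = (\<lambda>u. concat (map (\<lambda>t. map (Pair t) (s t u)) [0..<T]))"
  define W where "W = (\<lambda>u\<in>{..<n}. W' u @ replicate (k - length (W' u)) (T, u))"
  \<comment> \<open>Each listed transmission lengthens the basis by one, so the bound
    \<open>k\<close> on the basis also bounds the list.\<close>
  have "length (basis t u) =
      length (basis 0 u) + length (concat (map (\<lambda>t. map (Pair t) (s t u)) [0..<t]))" for t u
    by (induction t) (simp_all add: basis)
  from this[of T] have length_W': "length (W' u) \<le> k" if "u < n" for u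
    using length_basis_le[OF that, of T] unfolding W'_def by (metis add_leE)
  have "w < n" if "w \<in> set (s t u)" for w t u
    using that s[of t u] in_edges_less by blast
  then have "set (W' u) \<subseteq> {..T} \<times> {..<n}" for u
    by (auto simp: W'_def)
  then have "set (W' u @ replicate (k - length (W' u)) (T, u)) \<subseteq> {..T} \<times> {..<n}" if "u < n" for u
    using that by (auto simp: set_replicate_conv_if)
  then have "W \<in> witnesses n k T"
    unfolding W_def witnesses_def using length_W' by (intro restrict_PiE_iff[THEN iffD2]) auto
  moreover have "replay q m (initial_basis q k d tok I) W \<omega> t u = basis t u" if "t \<le> T" "u < n" for t u
    using that
  proof (induction t arbitrary: u)
    case 0
    then show ?case by (simp add: initial_basis_def basis_def m_def)
  next
    case (Suc t)
    have "filter (\<lambda>p. fst p = t) (W u) = map (Pair t) (s t u)"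
      using Suc.prems by (simp add: W_def W'_def filter_concat_map_Pair)
    moreover have "w < n" if "w \<in> set (s t u)" for w
      using that s in_edges_less by blast
    ultimately show ?case
      using Suc by (simp add: basis message_eq)
  qed
  ultimately show ?thesis by blast
qed

section \<open>Growth of the set of sensing nodes\<close>

definition sensing :: "fvec \<Rightarrow> nat \<Rightarrow> nat set" where
  "sensing \<mu> t = {u. u < n \<and> (\<exists>b\<in>set (basis t u). dot q k \<mu> b \<noteq> 0)}"

lemma sensing_mono: "sensing \<mu> t \<subseteq> sensing \<mu> (Suc t)"
proof
  fix u assume "u \<in> sensing \<mu> t"
  moreover obtain s where "basis (Suc t) u = basis t u @ map (message q k d tok I \<omega> G t) s"
    using basis_Suc by blast
  ultimately show "u \<in> sensing \<mu> (Suc t)" by (auto simp: sensing_def)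
qed

text \<open>Take a holder of a token \<open>j\<close> with \<open>\<mu> j \<noteq> 0\<close>: the
  coefficient part of its vector is a unit vector, so the inner product is
  \<open>\<mu> j\<close>.\<close>

lemma sensing_0_nonempty:
  assumes "\<mu> \<in> dual_vecs q k"
  shows "sensing \<mu> 0 \<noteq> {}"
proof -
  obtain j where j: "j < k" "\<mu> j \<noteq> 0" and \<mu>: "\<mu> \<in> field_vecs q k"
    using assms by (auto simp: dual_vecs_def)
  obtain u where u: "u < n" "j \<in> I u" "I u \<subseteq> {..<k}"
    using inst j by (auto simp: broadcast_instance_def)
  have "(\<Sum>i<k. \<mu> i * tok_vec q k d tok j i) = (\<Sum>i<k. if i = j then \<mu> i else 0)"
    by (intro sum.cong) (auto simp: tok_vec_def vec_dim_def)
  then have "dot q k \<mu> (tok_vec q k d tok j) = \<mu> j"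
    using j \<mu> by (auto simp: dot_def field_vecs_def PiE_def Pi_def)
  moreover have "tok_vec q k d tok j \<in> set (K 0 u)"
    using u finite_subset[OF u(3)] by auto
  ultimately have "u \<in> sensing \<mu> 0"
    using dot_innovative_nonzero[OF k_le_m] j(2) u(1) by (auto simp: sensing_def basis_def)
  then show ?thesis by blast
qed

text \<open>Connectivity yields an edge from a sensing node to one that does not sense. In a round
  that is not bad, the message along this edge is not orthogonal to \<open>\<mu>\<close>.\<close>

lemma sensing_progress:
  assumes "\<not> bad_round q m n k \<mu> basis \<omega> t" "sensing \<mu> t \<noteq> {}" "sensing \<mu> t \<noteq> {..<n}"
  shows "sensing \<mu> t \<subset> sensing \<mu> (Suc t)"
proof -
  obtain v v' where v: "v \<in> sensing \<mu> t" "v' < n" "v' \<notin> sensing \<mu> t"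
    using assms(2,3) by (auto simp: sensing_def)
  have "(v, v') \<in> (G t)\<^sup>*"
    using v connected by (auto simp: always_connected_def connected_graph_def sensing_def)
  then obtain w u where wu: "(w, u) \<in> G t" "w \<in> sensing \<mu> t" "u \<notin> sensing \<mu> t"
    using rtrancl_leaves_set[OF _ v(1) v(3)] by blast
  obtain j where "j < length (basis t w)" "dot q k \<mu> (basis t w ! j) \<noteq> 0"
    using wu(2) by (auto simp: sensing_def in_set_conv_nth)
  moreover have "w < n" "u < n" using in_edges_less[OF wu(1)] by auto
  ultimately have "dot q k \<mu> (message q k d tok I \<omega> G t w) \<noteq> 0"
    using assms(1) length_basis_le[of w t] by (fastforce simp: bad_round_def message_eq)
  moreover have "message q k d tok I \<omega> G t w \<in> set (K (Suc t) u)"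
    using wu(1) by (auto simp: known_Suc_eq_messages set_in_edges simp del: known.simps)
  ultimately have "u \<in> sensing \<mu> (Suc t)"
    using dot_innovative_nonzero[OF k_le_m] \<open>u < n\<close>
    by (auto simp: sensing_def basis_def simp del: known.simps)
  then show ?thesis using wu(3) sensing_mono by blast
qed

text \<open>The \<open>1\<close> is for an initially sensing node; the minimum with \<open>n\<close>
  is there because growth stops once all nodes sense.\<close>

lemma card_sensing_ge:
  assumes "\<mu> \<in> dual_vecs q k"
  shows "card (sensing \<mu> t) \<ge> min n (1 + card {s. s < t \<and> \<not> bad_round q m n k \<mu> basis \<omega> s})"
proof -
  have sub: "sensing \<mu> t \<subseteq> {..<n}" for t by (auto simp: sensing_def)
  have fin: "finite (sensing \<mu> t)" for t by (rule finite_subset[OF sub]) simp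
  have nonempty: "sensing \<mu> t \<noteq> {}" for t
    using sensing_0_nonempty[OF assms] sensing_mono[of \<mu>] by (induction t) auto
  show ?thesis
  proof (induction t)
    case 0
    have "card (sensing \<mu> 0) > 0" using nonempty fin by (simp add: card_gt_0_iff)
    then show ?case by simp
  next
    case (Suc t)
    let ?A = "\<lambda>t. {s. s < t \<and> \<not> bad_round q m n k \<mu> basis \<omega> s}"
    show ?case
    proof (cases "bad_round q m n k \<mu> basis \<omega> t \<or> sensing \<mu> t = {..<n}")
      case True
      then consider "?A (Suc t) = ?A t" | "sensing \<mu> t = {..<n}"
        by (auto simp: less_Suc_eq)
      then show ?thesis
        using Suc card_mono[OF fin sensing_mono, of t] by cases auto
    next
      case False
      then have "card (sensing \<mu> t) < card (sensing \<mu> (Suc t))"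
        by (intro psubset_card_mono fin sensing_progress nonempty) auto
      moreover have "?A (Suc t) = insert t (?A t)"
        using False by (auto simp: less_Suc_eq)
      ultimately show ?thesis using Suc by simp
    qed
  qed
qed

lemma all_decoded_if_sensing:
  assumes "\<And>\<mu>. \<mu> \<in> dual_vecs q k \<Longrightarrow> sensing \<mu> t = {..<n}"
  shows "all_decoded q n k d tok I \<omega> G t"
  unfolding all_decoded_def m_def[symmetric]
proof (intro allI impI)
  fix u i assume u: "u < n" and i: "i < k"
  have "vspan q m (basis t u) = vspan q m tokens"
    unfolding basis_def
    by (rule vspan_innovative_full[OF q known_subset_span[OF u]])
      (use assms u in \<open>auto simp: sensing_def basis_def tokens_def\<close>)
  moreover have "tok_vec q k d tok i \<in> vspan q m tokens"
    using i by (intro in_vspan_if_in_set tok_vec_in_field_vecs) (auto simp: tokens_def)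
  moreover have "vspan q m (basis t u) \<subseteq> vspan q m (K t u)"
    using set_innovative_subset known_subset_span[OF u] vspan_subset_field_vecs[OF q0]
    unfolding basis_def by (intro vspan_mono subsetI in_vspan_if_in_set) blast+
  ultimately show "tok_vec q k d tok i \<in> vspan q m (K t u)" by blast
qed

text \<open>Some \<open>\<mu>\<close> is not sensed everywhere after \<open>T\<close> rounds, so
  fewer than \<open>n\<close> rounds were good for it; \<open>R\<close> collects the others.
  Replayed bases replace the true ones, which removes the graphs from the description of
  failure.\<close>

lemma all_decoded_or_bad_rounds:
  assumes "\<not> all_decoded q n k d tok I \<omega> G T"
  shows "\<exists>W\<in>witnesses n k T. \<exists>\<mu>\<in>dual_vecs q k. \<exists>R\<subseteq>{..<T}. T - n \<le> card R \<and>
    (\<forall>t\<in>R. bad_round q m n k \<mu> (replay q m (initial_basis q k d tok I) W \<omega>) \<omega> t)"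
proof -
  obtain W where W: "W \<in> witnesses n k T"
    "\<And>t u. \<lbrakk>t \<le> T; u < n\<rbrakk> \<Longrightarrow> replay q m (initial_basis q k d tok I) W \<omega> t u = basis t u"
    using exists_witness[of T] by blast
  obtain \<mu> where \<mu>: "\<mu> \<in> dual_vecs q k" "sensing \<mu> T \<noteq> {..<n}"
    using assms all_decoded_if_sensing by blast
  define R where "R = {t. t < T \<and> bad_round q m n k \<mu> basis \<omega> t}"
  let ?good = "{t. t < T \<and> \<not> bad_round q m n k \<mu> basis \<omega> t}"
  have "sensing \<mu> T \<subset> {..<n}" using \<mu>(2) by (auto simp: sensing_def)
  then have "card (sensing \<mu> T) < n" using psubset_card_mono[of "{..<n}" "sensing \<mu> T"] by simp
  then have "card ?good < n" using card_sensing_ge[OF \<mu>(1), of T] by simp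
  moreover have "card ({..<T} - R) = T - card R"
    by (subst card_Diff_subset) (auto simp: R_def)
  moreover have "{..<T} - R = ?good" by (auto simp: R_def)
  ultimately have "T - n \<le> card R" by simp
  moreover have "bad_round q m n k \<mu> (replay q m (initial_basis q k d tok I) W \<omega>) \<omega> t" if "t \<in> R" for t
  proof -
    have "bad_round q m n k \<mu> basis \<omega> t" using that by (simp add: R_def)
    then show ?thesis
      using W(2)[of t] that by (subst bad_round_cong[where L' = basis]) (auto simp: R_def)
  qed
  ultimately show ?thesis using W(1) \<mu>(1) by (auto simp: R_def intro!: bexI exI[of _ R])
qed

end


section \<open>The union bound\<close>

lemma finite_dual_vecs: "finite (dual_vecs q k)"
  by (rule finite_subset[OF _ finite_field_vecs[of q k]]) (auto simp: dual_vecs_def)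

lemma card_dual_vecs_le: "card (dual_vecs q k) \<le> q ^ k"
  using card_mono[OF finite_field_vecs[of q k], of "dual_vecs q k"]
  by (auto simp: dual_vecs_def card_field_vecs)

text \<open>Whatever graphs \<open>A \<omega>\<close> are chosen, failure puts
  \<open>\<omega>\<close> into one of the events \<open>E (W, \<mu>, R)\<close>, which do not
  mention \<open>A\<close>. The three factors count witnesses, functionals and sets of
  rounds.\<close>

lemma prob_not_decoded_le:
  assumes q: "prime q" and inst: "broadcast_instance q n k d tok I"
    and A: "\<And>\<omega>. always_connected n (A \<omega>)" and nq: "n \<le> q"
  shows "measure_pmf.prob (coin_pmf q n k T) {\<omega>. \<not> all_decoded q n k d tok I \<omega> (A \<omega>) T}
    \<le> real ((n * (T + 1)) ^ (k * n) * q ^ k * 2 ^ T) * (real n / real q) ^ (T - n)"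
proof -
  let ?m = "vec_dim k d q"
  define X where "X = witnesses n k T \<times> dual_vecs q k \<times> {R. R \<subseteq> {..<T} \<and> T - n \<le> card R}"
  define E where "E = (\<lambda>(W, \<mu>, R). {\<omega>. \<forall>t\<in>R. bad_round q ?m n k \<mu>
      (replay q ?m (initial_basis q k d tok I) W \<omega>) \<omega> t})"
  have "finite {R. R \<subseteq> {..<T} \<and> T - n \<le> card R}"
    by (rule finite_subset[of _ "Pow {..<T}"]) auto
  then have finX: "finite X"
    by (simp add: X_def finite_witnesses finite_dual_vecs)
  have "card {R. R \<subseteq> {..<T} \<and> T - n \<le> card R} \<le> card (Pow {..<T})"
    by (rule card_mono) auto
  then have cardX: "card X \<le> (n * (T + 1)) ^ (k * n) * q ^ k * 2 ^ T"
    using card_dual_vecs_le[of q k]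
    by (simp add: X_def card_cartesian_product card_witnesses card_Pow mult_le_mono mult.assoc)
  have "{\<omega>. \<not> all_decoded q n k d tok I \<omega> (A \<omega>) T} \<subseteq> (\<Union>x\<in>X. E x)"
  proof
    fix \<omega> assume not_decoded: "\<omega> \<in> {\<omega>. \<not> all_decoded q n k d tok I \<omega> (A \<omega>) T}"
    interpret coding_execution q n k d tok I \<omega> "A \<omega>"
      using q inst A by unfold_locales
    obtain W \<mu> R where "(W, \<mu>, R) \<in> X" "\<omega> \<in> E (W, \<mu>, R)"
      using all_decoded_or_bad_rounds[of T] not_decoded by (fastforce simp: X_def E_def m_def)
    then show "\<omega> \<in> (\<Union>x\<in>X. E x)" by blast
  qed
  then have "measure_pmf.prob (coin_pmf q n k T) {\<omega>. \<not> all_decoded q n k d tok I \<omega> (A \<omega>) T}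
      \<le> measure_pmf.prob (coin_pmf q n k T) (\<Union>x\<in>X. E x)"
    by (intro measure_pmf.finite_measure_mono) auto
  also have "\<dots> \<le> (\<Sum>x\<in>X. measure_pmf.prob (coin_pmf q n k T) (E x))"
    by (rule measure_UNION_le[OF finX]) auto
  also have "\<dots> \<le> (\<Sum>x\<in>X. (real n / real q) ^ (T - n))"
  proof (rule sum_mono)
    fix x assume "x \<in> X"
    then obtain W \<mu> R where x: "x = (W, \<mu>, R)" "R \<subseteq> {..<T}" "T - n \<le> card R"
      by (auto simp: X_def)
    have "measure_pmf.prob (coin_pmf q n k T) (E x) \<le> (real n / real q) ^ card R"
      unfolding x(1) E_def prod.case by (rule prob_bad_rounds_le[OF q _ x(2)]) (simp add: vec_dim_def)
    \<comment> \<open>By \<open>n \<le> q\<close> the base is at most \<open>1\<close>, so further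
      bad rounds only lower the bound.\<close>
    also have "\<dots> \<le> (real n / real q) ^ (T - n)"
      using x(3) nq prime_gt_0_nat[OF q] by (intro power_decreasing) auto
    finally show "measure_pmf.prob (coin_pmf q n k T) (E x) \<le> (real n / real q) ^ (T - n)" .
  qed
  also have "\<dots> \<le> real ((n * (T + 1)) ^ (k * n) * q ^ k * 2 ^ T) * (real n / real q) ^ (T - n)"
    using cardX unfolding sum_constant by (intro mult_right_mono of_nat_mono) auto
  finally show ?thesis .
qed

section \<open>Arithmetic of the union bound and the choice of constants\<close>

text \<open>The chain is \<open>(1 + k / n) ^ n \<le> exp k \<le> 4 ^ k \<le> n ^ (2 * k)\<close>.
  No fixed power of \<open>n\<close> bounds \<open>n + k\<close> for large \<open>k\<close>, but
  under the outer exponent \<open>n\<close> the excess costs only \<open>2 * k\<close> in the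
  exponent.\<close>

lemma add_power_le:
  assumes "2 \<le> (n::nat)"
  shows "(n + k) ^ n \<le> n ^ (n + 2 * k)"
proof -
  have "exp (real k) = exp 1 ^ k" by (simp flip: exp_of_nat_mult)
  also have "\<dots> \<le> 4 ^ k" using exp_le by (intro power_mono) auto
  finally have "(1 + real k / real n) ^ n \<le> 4 ^ k"
    using exp_ge_one_plus_x_over_n_power_n[of n "real k"] assms by simp
  also have "(4::real) ^ k = 2 ^ (2 * k)" by (simp add: power_mult)
  also have "\<dots> \<le> real n ^ (2 * k)" using assms by (intro power_mono) auto
  finally have "real n ^ n * (1 + real k / real n) ^ n \<le> real n ^ n * real n ^ (2 * k)"
    by (intro mult_left_mono) auto
  also have "real n ^ n * (1 + real k / real n) ^ n = (real n + real k) ^ n"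
    using assms by (subst power_mult_distrib[symmetric]) (simp add: algebra_simps)
  finally have "real ((n + k) ^ n) \<le> real (n ^ (n + 2 * k))"
    by (simp add: power_add)
  then show ?thesis by (simp only: of_nat_le_iff)
qed

text \<open>The powers of \<open>n\<close> have total exponent at most
  \<open>(4 * n + 2 * k) * k + 2 * T * k = (10 * n + 8 * k) * k\<close>, so
  \<open>q \<ge> n ^ (10 * k)\<close> absorbs them into \<open>q ^ (n + k)\<close>. With
  \<open>q ^ k\<close> functionals and the target \<open>q ^ n\<close> the exponent of
  \<open>q\<close> becomes \<open>2 * (n + k)\<close>, which fits into
  \<open>T - n = 2 * n + 3 * k\<close>.\<close>

lemma union_bound_arithmetic:
  fixes n k q :: nat
  assumes n: "2 \<le> n" and k: "1 \<le> k" and q: "n ^ (10 * k) \<le> q"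
  defines "T \<equiv> 3 * (n + k)"
  shows "(n * (T + 1)) ^ (k * n) * q ^ k * 2 ^ T * n ^ (T - n) * q ^ n \<le> q ^ (T - n)"
proof -
  have q1: "1 \<le> q" using q n by (metis one_le_power le_trans one_le_numeral)
  have n1: "1 \<le> n" using n by simp
  have "T + 1 \<le> 2 ^ 2 * (n + k)" using n by (simp add: T_def)
  also have "\<dots> \<le> n ^ 2 * (n + k)" using n by (intro mult_right_mono power_mono) auto
  finally have "n * (T + 1) \<le> n * (n ^ 2 * (n + k))" by (rule mult_le_mono2)
  also have "\<dots> = n ^ 3 * (n + k)"
    by (simp add: power2_eq_square power3_eq_cube mult.assoc)
  finally have "n * (T + 1) \<le> n ^ 3 * (n + k)" .
  then have "(n * (T + 1)) ^ n \<le> (n ^ 3 * (n + k)) ^ n" by (rule power_mono) simp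
  also have "\<dots> \<le> n ^ (3 * n) * n ^ (n + 2 * k)"
    using add_power_le[OF n] by (simp add: power_mult_distrib power_mult)
  also have "\<dots> = n ^ (4 * n + 2 * k)" by (simp flip: power_add)
  finally have "((n * (T + 1)) ^ n) ^ k \<le> (n ^ (4 * n + 2 * k)) ^ k" by (rule power_mono) simp
  then have 1: "(n * (T + 1)) ^ (k * n) \<le> n ^ ((4 * n + 2 * k) * k)"
    by (simp add: power_mult mult.commute[of k] flip: power_mult)
  have "(2::nat) ^ T \<le> n ^ T" using n by (intro power_mono) auto
  also have "\<dots> \<le> n ^ (T * k)" using n1 k by (intro power_increasing) auto
  finally have 2: "2 ^ T \<le> n ^ (T * k)" .
  have "T - n \<le> T * k" using k by (metis diff_le_self le_trans mult.right_neutral mult_le_mono2)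
  then have 3: "n ^ (T - n) \<le> n ^ (T * k)" using n1 by (intro power_increasing)
  have "(n * (T + 1)) ^ (k * n) * 2 ^ T * n ^ (T - n)
      \<le> n ^ ((4 * n + 2 * k) * k) * n ^ (T * k) * n ^ (T * k)"
    using 1 2 3 by (intro mult_le_mono)
  also have "\<dots> = n ^ ((10 * n + 8 * k) * k)"
    by (simp add: T_def algebra_simps flip: power_add)
  also have "\<dots> \<le> n ^ (10 * k * (n + k))"
    using n1 by (intro power_increasing) (auto simp: algebra_simps)
  also have "\<dots> = (n ^ (10 * k)) ^ (n + k)" by (rule power_mult)
  also have "\<dots> \<le> q ^ (n + k)" using q by (rule power_mono) simp
  finally have "(n * (T + 1)) ^ (k * n) * 2 ^ T * n ^ (T - n) * (q ^ k * q ^ n)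
      \<le> q ^ (n + k) * (q ^ k * q ^ n)" by (rule mult_right_mono) simp
  also have "\<dots> = q ^ (2 * n + 2 * k)"
    unfolding power_add[symmetric] by (rule arg_cong[where f = "power q"]) simp
  also have "\<dots> \<le> q ^ (T - n)" using q1 by (intro power_increasing) (auto simp: T_def)
  finally show ?thesis by (simp add: ac_simps)
qed

text \<open>For one node the lower bound on \<open>q\<close> degenerates to
  \<open>1 \<le> q\<close>, so this case is settled without probability: the initially sensing node
  is already the whole network.\<close>

lemma (in coding_execution) all_decoded_single_node:
  assumes "n = 1"
  shows "all_decoded q n k d tok I \<omega> G t"
proof (rule all_decoded_if_sensing)
  fix \<mu> assume "\<mu> \<in> dual_vecs q k"
  then have "card {..<n} \<le> card (sensing \<mu> t)"
    using card_sensing_ge[of \<mu> t] assms by simp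
  then show "sensing \<mu> t = {..<n}"
    by (intro card_seteq) (auto simp: sensing_def)
qed

lemma prob_all_decoded_ge:
  assumes n: "1 \<le> n" and k: "1 \<le> k" and q: "prime q" and nq: "n ^ (10 * k) \<le> q"
    and inst: "broadcast_instance q n k d tok I"
    and A: "\<And>\<omega>. always_connected n (A \<omega>)"
  shows "measure_pmf.prob (coin_pmf q n k (3 * (n + k)))
    {\<omega>. all_decoded q n k d tok I \<omega> (A \<omega>) (3 * (n + k))} \<ge> 1 - 1 / real q ^ n"
proof (cases "n = 1")
  case True
  have "all_decoded q n k d tok I \<omega> (A \<omega>) t" for \<omega> t
  proof -
    interpret coding_execution q n k d tok I \<omega> "A \<omega>"
      using q inst A by unfold_locales
    show ?thesis using True by (rule all_decoded_single_node)
  qed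
  then show ?thesis by simp
next
  case False
  then have n2: "2 \<le> n" using n by simp
  have q0: "q > 0" using q by (rule prime_gt_0_nat)
  define T where "T = 3 * (n + k)"
  let ?p = "coin_pmf q n k T" and ?D = "{\<omega>. all_decoded q n k d tok I \<omega> (A \<omega>) T}"
  have "n \<le> n ^ (10 * k)" using n k by (intro self_le_power) auto
  then have "n \<le> q" using nq by simp
  note prob_not_decoded_le[OF q inst A this, of T]
  also have "real ((n * (T + 1)) ^ (k * n) * q ^ k * 2 ^ T) * (real n / real q) ^ (T - n)
      \<le> 1 / real q ^ n"
  proof -
    have "real ((n * (T + 1)) ^ (k * n) * q ^ k * 2 ^ T * n ^ (T - n) * q ^ n) \<le> real (q ^ (T - n))"
      unfolding of_nat_le_iff T_def by (rule union_bound_arithmetic[OF n2 k nq])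
    then show ?thesis
      using q0 by (simp add: power_divide field_simps)
  qed
  finally have "measure_pmf.prob ?p (- ?D) \<le> 1 / real q ^ n"
    by (simp add: Collect_neg_eq)
  moreover have "measure_pmf.prob ?p (- ?D) = 1 - measure_pmf.prob ?p ?D"
    using measure_pmf.prob_compl[of ?D ?p] by (simp add: Compl_eq_Diff_UNIV)
  ultimately show ?thesis by (simp add: T_def)
qed

section \<open>Message length\<close>

lemma encodable_with_bits_if_card_le:
  assumes "finite M" "card M \<le> 2 ^ b"
  shows "encodable_with_bits M b"
proof -
  let ?B = "{xs :: bool list. set xs \<subseteq> UNIV \<and> length xs = b}"
  have "card ?B = 2 ^ b" by (subst card_lists_length_eq) auto
  moreover have "finite ?B" by (rule finite_lists_length_eq) simp
  ultimately obtain f where "f ` M \<subseteq> ?B" "inj_on f M"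
    using inj_on_iff_card_le[of M ?B] assms by auto
  then show ?thesis by (force simp: encodable_with_bits_def)
qed

text \<open>All vectors of length \<open>vec_dim k d q\<close> are encoded, at
  \<open>log 2 q\<close> bits per coordinate. As \<open>log 2 q\<close> is at most
  \<open>\<bar>c\<bar> * k * log 2 n\<close>, the coefficients cost
  \<open>O(k ^ 2 * log 2 n)\<close>; the token part costs \<open>d\<close> plus at most one
  coordinate for rounding.\<close>

lemma message_bits_le:
  fixes c :: real
  assumes n: "1 \<le> n" and k: "1 \<le> k" and q: "prime q" and qn: "real q \<le> real n powr (c * real k)"
  shows "\<exists>b::nat. real b \<le> (2 * \<bar>c\<bar> + 2) * (real k ^ 2 * log 2 (real n) + real d) \<and>
    encodable_with_bits (possible_messages q n k d T) b"
proof -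
  have q1: "1 < q" using q by (rule prime_gt_1_nat)
  \<comment> \<open>For \<open>n = 1\<close> the upper bound on \<open>q\<close> would read
    \<open>q \<le> 1\<close>.\<close>
  have "n \<noteq> 1" using qn q1 by auto
  then have n2: "2 \<le> n" using n by simp
  let ?l = "log 2 (real n)" and ?m = "vec_dim k d q"
  have l1: "1 \<le> ?l" using n2 by simp
  have lq: "0 < log 2 (real q)" using q1 by simp
  define x where "x = real ?m * log 2 (real q)"
  define b where "b = nat \<lceil>x\<rceil>"
  have "log 2 (real q) \<le> log 2 (real n powr (c * real k))"
    using qn q1 by (intro log_mono) auto
  also have "\<dots> = c * real k * ?l" using n2 by (simp add: log_powr)
  also have "\<dots> \<le> \<bar>c\<bar> * real k * ?l" using l1 by (intro mult_right_mono) auto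
  finally have lqn: "log 2 (real q) \<le> \<bar>c\<bar> * real k * ?l" .
  have x0: "0 \<le> x" using lq by (simp add: x_def)
  have "real (tok_dim d q) \<le> real d / log 2 (real q) + 1"
    using lq by (simp add: tok_dim_def)
  then have "real (tok_dim d q) * log 2 (real q) \<le> (real d / log 2 (real q) + 1) * log 2 (real q)"
    using lq by (intro mult_right_mono) auto
  also have "\<dots> = real d + log 2 (real q)" using lq by (simp add: field_simps)
  finally have "x \<le> (real k + 1) * log 2 (real q) + real d"
    by (simp add: x_def vec_dim_def algebra_simps)
  also have "\<dots> \<le> (2 * real k) * (\<bar>c\<bar> * real k * ?l) + real d"
    using lqn lq k by (intro add_right_mono mult_mono) auto
  also have "\<dots> = 2 * \<bar>c\<bar> * (real k ^ 2 * ?l) + real d" by (simp add: power2_eq_square)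
  finally have x: "x \<le> 2 * \<bar>c\<bar> * (real k ^ 2 * ?l) + real d" .
  \<comment> \<open>This absorbs the extra bit that comes from rounding \<open>x\<close> up.\<close>
  have kl: "1 \<le> real k ^ 2 * ?l"
    using mult_mono[of 1 "real k ^ 2" 1 ?l] l1 k by simp
  have "real b \<le> x + 1" using x0 by (simp add: b_def)
  also have "\<dots> \<le> 2 * \<bar>c\<bar> * (real k ^ 2 * ?l) + real d + real k ^ 2 * ?l" using x kl by simp
  also have "\<dots> \<le> (2 * \<bar>c\<bar> + 2) * (real k ^ 2 * ?l + real d)"
    using kl by (simp add: algebra_simps)
  finally have 1: "real b \<le> (2 * \<bar>c\<bar> + 2) * (real k ^ 2 * ?l + real d)" .
  have sub: "possible_messages q n k d T \<subseteq> field_vecs q ?m"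
    using q1 by (auto simp: possible_messages_def message_def lincomb_in_field_vecs)
  have "real (q ^ ?m) = 2 powr x"
    using q1 by (simp add: x_def mult.commute[of "real ?m"] flip: powr_powr powr_realpow)
  also have "\<dots> \<le> 2 powr real b"
    by (intro powr_mono) (simp_all add: b_def real_nat_ceiling_ge)
  also have "\<dots> = real (2 ^ b)" by (simp add: powr_realpow)
  finally have "q ^ ?m \<le> 2 ^ b" by (simp only: of_nat_le_iff)
  then have "encodable_with_bits (possible_messages q n k d T) b"
    using card_mono[OF finite_field_vecs sub] finite_subset[OF sub finite_field_vecs]
    by (intro encodable_with_bits_if_card_le) (auto simp: card_field_vecs)
  with 1 show ?thesis by blast
qed

text \<open>The constants \<open>c\<^sub>0\<close> and \<open>C\<close> are absolute. Decoding
  relies on a lower bound on \<open>q\<close>, the message length on an upper bound of the same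
  shape, with a factor \<open>D\<close> that depends on \<open>c\<^sub>1\<close> alone. The
  adversary \<open>A\<close> sees the coins of all rounds.\<close>

theorem theorem10:
  shows "\<exists>(c\<^sub>0::real) > 0. \<exists>C::nat. \<forall>c\<^sub>1::real. \<exists>D::real.
    \<forall>n k d q :: nat. 1 \<le> n \<longrightarrow> 1 \<le> k \<longrightarrow> prime q \<longrightarrow> real n powr (c\<^sub>0 * real k) \<le> real q \<longrightarrow>
      (\<forall>tok I A.
         broadcast_instance q n k d tok I \<longrightarrow>
         (\<forall>\<omega>. always_connected n (A \<omega>)) \<longrightarrow>
         measure_pmf.prob (coin_pmf q n k (C * (n + k)))
           {\<omega>. all_decoded q n k d tok I \<omega> (A \<omega>) (C * (n + k))} \<ge> 1 - 1 / real q ^ n) \<and>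
      (real q \<le> real n powr (c\<^sub>1 * real k) \<longrightarrow>
         (\<exists>b::nat. real b \<le> D * (real k ^ 2 * log 2 (real n) + real d) \<and>
            encodable_with_bits (possible_messages q n k d (C * (n + k))) b))"
\<comment> \<open>The values \<open>10\<close> and \<open>3\<close> are those balanced in
  \<open>union_bound_arithmetic\<close>.\<close>
proof (rule exI[of _ 10], intro conjI, simp, rule exI[of _ 3], rule allI)
  fix c\<^sub>1 :: real
  have q: "n ^ (10 * k) \<le> q" if "1 \<le> n" "real n powr (10 * real k) \<le> real q" for n k q :: nat
  proof -
    have "real n powr (10 * real k) = real n ^ (10 * k)"
      using that(1) by (simp flip: powr_realpow)
    then have "real (n ^ (10 * k)) \<le> real q" using that(2) by simp
    then show ?thesis by (simp only: of_nat_le_iff)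
  qed
  show "\<exists>D::real.
    \<forall>n k d q :: nat. 1 \<le> n \<longrightarrow> 1 \<le> k \<longrightarrow> prime q \<longrightarrow> real n powr (10 * real k) \<le> real q \<longrightarrow>
      (\<forall>tok I A.
         broadcast_instance q n k d tok I \<longrightarrow>
         (\<forall>\<omega>. always_connected n (A \<omega>)) \<longrightarrow>
         measure_pmf.prob (coin_pmf q n k (3 * (n + k)))
           {\<omega>. all_decoded q n k d tok I \<omega> (A \<omega>) (3 * (n + k))} \<ge> 1 - 1 / real q ^ n) \<and>
      (real q \<le> real n powr (c\<^sub>1 * real k) \<longrightarrow>
         (\<exists>b::nat. real b \<le> D * (real k ^ 2 * log 2 (real n) + real d) \<and>
            encodable_with_bits (possible_messages q n k d (3 * (n + k))) b))"
    by (intro exI[of _ "2 * \<bar>c\<^sub>1\<bar> + 2"] allI impI conjI prob_all_decoded_ge q message_bits_le) auto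
qed

end
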